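(* Let $n\geqslant1$, $\tau>0$, $m>0$ with $m\tau<1$, and let $0<\delta\ll1$. Let $\psi^{\delta>0}$ be the solution to $$\begin{cases}\tau\psi_{ttt}+\psi_{tt}-\Delta\psi-(\delta+\tau)\Delta\psi_t+\displaystyle\int_0^t m\,\mathrm{e}^{-\frac{t-\eta}{\tau}}\Delta\psi(\eta,x)\,\mathrm{d}\eta=0,& x\in\mathbb{R}^n,\ t>0,\\ (\psi,\psi_t,\psi_{tt})(0,x)=(\psi_0,\psi_1,\psi_2)(x),& x\in\mathbb{R}^n,\end{cases}$$ and let $\psi^{\delta=0}$ be the solution to the same problem with $\delta$ replaced by $0$ and with the same initial data $(\psi_0,\psi_1,\psi_2)$. (i) If $(\psi_0,\psi_1,\psi_2)\in(H^{s_0+1}_1)^2\times H^{s_0}_1$ with $s_0>n+2$, then $$\sup_{t\in[0,+\infty)}\|\psi^{\delta>0}(t,\cdot)-\psi^{\delta=0}(t,\cdot)\|_{\mathrm{E}_\infty}\leqslant C\sqrt{\delta}\,\|(\psi_0,\psi_1,\psi_2)\|_{(H^{s_0+1}_1)^2\times H^{s_0}_1}.$$ (ii) If $(\psi_0,\psi_1,\psi_2)\in(H^{s_1+1}_1\cap\dot H^{-1}_1)^2\times(H^{s_1}_1\cap\dot H^{-1}_1)$ with $s_1>n+1$, then for every $T>0$ $$\sup_{t\in[0,T]}\|\psi^{\delta>0}(t,\cdot)-\psi^{\delta=0}(t,\cdot)\|_{L^\infty}\leqslant C_T\sqrt{\delta}\,\|(\psi_0,\psi_1,\psi_2)\|_{(H^{s_1+1}_1\cap\dot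 H^{-1}_1)^2\times(H^{s_1}_1\cap\dot H^{-1}_1)}.$$ Here the constants $C$ and $C_T$ are positive and independent of $\delta$ ($C_T$ may depend on $T$).
   Context: The solutions are understood through the partial Fourier transform in $x$: for each $\xi\in\mathbb{R}^n$, $\widehat\psi(\cdot,\xi)$ is the unique solution of the linear integro-differential ODE obtained by replacing $\Delta$ by $-|\xi|^2$, with initial data $(\widehat\psi_0,\widehat\psi_1,\widehat\psi_2)(\xi)$. For a function $u=u(t,x)$, $$\|u(t,\cdot)\|_{\mathrm{E}_\infty}:=\left\|\left(|D|u_t+\frac{\delta+2\tau}{2\tau(\delta+\tau)}|D|u\right)(t,\cdot)\right\|_{L^\infty}+\left\|\left(u_{tt}+\frac{\delta+2\tau}{2\tau(\delta+\tau)}u_t\right)(t,\cdot)\right\|_{L^\infty}.$$ $|D|^s$ and $\langle D\rangle^{-s}$ are the Fourier multipliers with symbols $|\xi|^s$ and $\langle\xi\rangle^{-s}=(1+|\xi|^2)^{-s/2}$. For $s>0$: $H^s_1:=\langle D\rangle^{-s}L^1$ is the Bessel potential space with norm $\|f\|_{H^s_1}=\|\langle D\rangle^{s}f\|_{L^1}$, and $\dot H^{-s}_1:=|D|^{s}L^1$ is the Riesz potential space of negative order with norm $\|f\|_{\dot H^{-s}_1}=\||D|^{-s}f\|_{L^1}$; all over $\mathbb{R}^n$. "$0<\delta\ll1$" means $0<\delta\leqslant\delta_0$ for some sufficiently small $\delta_0>0$. The constants $C,C_T$ may depend on $n,\tau,m,s_0,s_1$ but not on the initial data. *)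

theory Defs
  imports "HOL-Analysis.Analysis" "HOL-Probability.Essential_Supremum"
begin

definition fourier :: "(real^'n \<Rightarrow> complex) \<Rightarrow> real^'n \<Rightarrow> complex" where
  "fourier f \<xi> = (LINT x|lborel. cis (- (x \<bullet> \<xi>)) * f x)"

definition inv_fourier :: "(real^'n \<Rightarrow> complex) \<Rightarrow> real^'n \<Rightarrow> complex" where
  "inv_fourier F x = (LINT \<xi>|lborel. cis (x \<bullet> \<xi>) * F \<xi>) / complex_of_real ((2 * pi) ^ CARD('n))"

definition L1_norm :: "(real^'n \<Rightarrow> complex) \<Rightarrow> real" where
  "L1_norm g = (LINT x|lborel. norm (g x))"

text \<open>The value is \<open>\<infinity>\<close> if \<open>f\<close> is not measurable or not essentially bounded.\<close>

definition Linf_norm :: "(real^'n \<Rightarrow> complex) \<Rightarrow> ereal" where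
  "Linf_norm f = esssup lborel (\<lambda>x. ereal (norm (f x)))"

text \<open>\<open>L1_multiplier a g f\<close>: both \<open>g\<close> and \<open>f\<close> are in L1, and \<open>f\<close> is the image of \<open>g\<close> under
  the Fourier multiplier with symbol \<open>a\<close>.\<close>

definition L1_multiplier ::
    "(real^'n \<Rightarrow> real) \<Rightarrow> (real^'n \<Rightarrow> complex) \<Rightarrow> (real^'n \<Rightarrow> complex) \<Rightarrow> bool" where
  "L1_multiplier a g f \<longleftrightarrow> integrable lborel g \<and> integrable lborel f \<and>
     (\<forall>\<xi>. fourier f \<xi> = complex_of_real (a \<xi>) * fourier g \<xi>)"

definition bessel_symbol :: "real \<Rightarrow> real^'n \<Rightarrow> real" where
  "bessel_symbol s \<xi> = (1 + (norm \<xi>)\<^sup>2) powr (s / 2)"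

definition riesz_symbol :: "real \<Rightarrow> real^'n \<Rightarrow> real" where
  "riesz_symbol s \<xi> = norm \<xi> powr s"

text \<open>For \<open>s > 0\<close> the Bessel kernel is in L1, so every element of the Bessel potential space of
  order \<open>s\<close> over L1 is an L1 function, and requiring this in \<open>L1_multiplier\<close> is no restriction.
  The function \<open>g\<close> chosen in the norm is unique up to a null set, because the Fourier transform
  is injective on L1.\<close>

definition H1_space :: "real \<Rightarrow> (real^'n \<Rightarrow> complex) set" where
  "H1_space s = {f. \<exists>g. L1_multiplier (bessel_symbol (- s)) g f}"

definition H1_norm :: "real \<Rightarrow> (real^'n \<Rightarrow> complex) \<Rightarrow> real" where
  "H1_norm s f = L1_norm (SOME g. L1_multiplier (bessel_symbol (- s)) g f)"

text \<open>For \<open>s > 0\<close>, the L1 functions in the Riesz potential space of order \<open>- s\<close>, that is, those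
  of the form \<open>f = |D|\<^sup>s g\<close> with \<open>g\<close> in L1; their norm is the L1 norm of \<open>g\<close>. The full space also
  contains distributions that are not L1 functions; these never lie in a space \<open>H1_space r\<close> with
  \<open>r > 0\<close>, so intersections with such a space are not affected.\<close>

definition riesz1_space :: "real \<Rightarrow> (real^'n \<Rightarrow> complex) set" where
  "riesz1_space s = {f. \<exists>g. L1_multiplier (riesz_symbol s) g f}"

definition riesz1_norm :: "real \<Rightarrow> (real^'n \<Rightarrow> complex) \<Rightarrow> real" where
  "riesz1_norm s f = L1_norm (SOME g. L1_multiplier (riesz_symbol s) g f)"

text \<open>The integro-differential ODE at a frequency of modulus \<open>\<rho>\<close>, obtained from the equation by
  replacing the Laplacian by \<open>- \<rho>\<^sup>2\<close>. Derivatives at \<open>t = 0\<close> are one-sided.\<close>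

definition mode_solution ::
    "real \<Rightarrow> real \<Rightarrow> real \<Rightarrow> real \<Rightarrow> complex \<Rightarrow> complex \<Rightarrow> complex \<Rightarrow> (real \<Rightarrow> complex) \<Rightarrow> bool" where
  "mode_solution \<tau> m \<delta> \<rho> a b c y \<longleftrightarrow>
     (\<exists>y1 y2 y3.
        (\<forall>t\<ge>0. (y has_vector_derivative y1 t) (at t within {0..}) \<and>
               (y1 has_vector_derivative y2 t) (at t within {0..}) \<and>
               (y2 has_vector_derivative y3 t) (at t within {0..})) \<and>
        y 0 = a \<and> y1 0 = b \<and> y2 0 = c \<and>
        (\<forall>t>0. \<tau> *\<^sub>R y3 t + y2 t - (- \<rho>\<^sup>2) *\<^sub>R y t - ((\<delta> + \<tau>) * (- \<rho>\<^sup>2)) *\<^sub>R y1 t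
               + integral {0..t} (\<lambda>\<eta>. (m * exp (- (t - \<eta>) / \<tau>) * (- \<rho>\<^sup>2)) *\<^sub>R y \<eta>) = 0))"

text \<open>\<open>\<Psi>\<close> is the partial Fourier transform of \<open>\<psi>\<close> in \<open>x\<close>.\<close>

definition mgt_solution ::
    "real \<Rightarrow> real \<Rightarrow> real \<Rightarrow> (real^'n \<Rightarrow> complex) \<Rightarrow> (real^'n \<Rightarrow> complex) \<Rightarrow> (real^'n \<Rightarrow> complex)
      \<Rightarrow> (real \<Rightarrow> real^'n \<Rightarrow> complex) \<Rightarrow> bool" where
  "mgt_solution \<tau> m \<delta> \<psi>0 \<psi>1 \<psi>2 \<psi> \<longleftrightarrow>
     (\<exists>\<Psi>. (\<forall>\<xi>. mode_solution \<tau> m \<delta> (norm \<xi>) (fourier \<psi>0 \<xi>) (fourier \<psi>1 \<xi>) (fourier \<psi>2 \<xi>)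
                 (\<lambda>t. \<Psi> t \<xi>)) \<and>
          (\<forall>t\<ge>0. integrable lborel (\<Psi> t) \<and> (\<forall>x. \<psi> t x = inv_fourier (\<Psi> t) x)))"

definition time_derivative ::
    "(real \<Rightarrow> real^'n \<Rightarrow> complex) \<Rightarrow> (real \<Rightarrow> real^'n \<Rightarrow> complex) \<Rightarrow> bool" where
  "time_derivative u v \<longleftrightarrow>
     (\<forall>t\<ge>0. \<forall>x. ((\<lambda>s. u s x) has_vector_derivative v t x) (at t within {0..}))"

text \<open>\<open>g = |D| f\<close>, where \<open>f\<close> and \<open>g\<close> need not be in L1 but have integrable Fourier transforms.\<close>

definition abs_D :: "(real^'n \<Rightarrow> complex) \<Rightarrow> (real^'n \<Rightarrow> complex) \<Rightarrow> bool" where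
  "abs_D f g \<longleftrightarrow>
     (\<exists>F. integrable lborel F \<and> integrable lborel (\<lambda>\<xi>. complex_of_real (norm \<xi>) * F \<xi>) \<and>
          (\<forall>x. f x = inv_fourier F x) \<and>
          (\<forall>x. g x = inv_fourier (\<lambda>\<xi>. complex_of_real (norm \<xi>) * F \<xi>) x))"

text \<open>Time derivatives and \<open>|D|\<close> are unique when they exist, so the set below has at most one
  element. It is empty, and the value is then \<open>\<infinity>\<close>, if one of them does not exist.\<close>

definition E_inf_norm :: "real \<Rightarrow> real \<Rightarrow> (real \<Rightarrow> real^'n \<Rightarrow> complex) \<Rightarrow> real \<Rightarrow> ereal" where
  "E_inf_norm \<tau> \<delta> u t =
     (let \<kappa> = complex_of_real ((\<delta> + 2 * \<tau>) / (2 * \<tau> * (\<delta> + \<tau>))) in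
      Inf {Linf_norm (\<lambda>x. Du1 x + \<kappa> * Du x) + Linf_norm (\<lambda>x. u2 t x + \<kappa> * u1 t x) | u1 u2 Du Du1.
           time_derivative u u1 \<and> time_derivative u1 u2 \<and> abs_D (u t) Du \<and> abs_D (u1 t) Du1})"

end

theory Submission
  imports Defs
begin

text \<open>Put \<open>v = \<tau> u' + u\<close>, let \<open>z\<close> be the memory integral, \<open>p = z' = u - z / \<tau>\<close> and \<open>A = |\<xi>|\<^sup>2\<close>.
  A mode satisfies \<open>v'' + A (v - m z) + \<delta> A u' = 0\<close>, and for \<open>m \<tau> < 1\<close> a positive energy \<open>E\<close>,
  comparable with \<open>|v'|\<^sup>2 + A |v|\<^sup>2\<close> plus lower terms, has derivative
  \<open>- 2 m A |p|\<^sup>2 - \<delta> A |u'|\<^sup>2\<close>. Already the memory dissipation \<open>A |p|\<^sup>2\<close> controls \<open>v'\<close> after adding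
  a multiplier term: \<open>A \<integral> |v'|\<^sup>2 \<le> C (1 + A)\<^sup>2 E(0)\<close> uniformly in \<open>\<delta>\<close>, up to lower order data.

  The difference \<open>w\<close> of the modes for \<open>\<delta> > 0\<close> and \<open>\<delta> = 0\<close> solves the equation with zero data and
  source \<open>- \<delta> A U'\<close>, \<open>U\<close> being the mode for \<open>\<delta> = 0\<close>. Its energy is therefore at most
  \<open>\<delta> A \<integral> |U'| |v'|\<close>, and Cauchy-Schwarz with the previous bound for both modes gives
  \<open>C \<delta> (1 + A)\<^sup>2\<close> times the data: a factor \<open>sqrt \<delta>\<close> at the cost of two derivatives, which
  \<open>s0 > n + 2\<close> makes integrable in \<open>\<xi>\<close>. On \<open>[0, T]\<close> low frequencies of \<open>w\<close> are
  controlled by \<open>|w| \<le> T sup |w'|\<close>.\<close>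

section \<open>Energy method for a scalar mode\<close>

text \<open>\<open>u1\<close>, \<open>u2\<close> are the derivatives of \<open>u\<close>, the function \<open>z\<close> replaces the memory integral, and
  \<open>h\<close> is a source. The equations are only required for \<open>t > 0\<close>, as in \<open>mode_solution\<close>.\<close>

definition memory_system ::
    "real \<Rightarrow> real \<Rightarrow> real \<Rightarrow> real \<Rightarrow> (real \<Rightarrow> real) \<Rightarrow> (real \<Rightarrow> real) \<Rightarrow> (real \<Rightarrow> real) \<Rightarrow> (real \<Rightarrow> real)
      \<Rightarrow> (real \<Rightarrow> real) \<Rightarrow> bool" where
  "memory_system \<tau> m \<delta> A h u u1 u2 z \<longleftrightarrow>
     continuous_on {0..} u \<and> continuous_on {0..} u1 \<and> continuous_on {0..} u2 \<and>
     continuous_on {0..} z \<and> z 0 = 0 \<and>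
     (\<forall>t>0. (u has_real_derivative u1 t) (at t) \<and> (u1 has_real_derivative u2 t) (at t) \<and>
       (u2 has_real_derivative - (u2 t + A * u t + (\<delta> + \<tau>) * A * u1 t - m * A * z t + h t) / \<tau>) (at t) \<and>
       (z has_real_derivative u t - z t / \<tau>) (at t))"

text \<open>The damping terms combine as \<open>(\<delta> + \<tau>) * A * u1 - \<tau> * A * U1 =
  (\<delta> + \<tau>) * A * (u1 - U1) + \<delta> * A * U1\<close>, and the last summand is the
  source.\<close>

lemma memory_system_diff:
  assumes "memory_system \<tau> m \<delta> A (\<lambda>t. 0) u u1 u2 z" "memory_system \<tau> m 0 A (\<lambda>t. 0) U U1 U2 Z"
  shows "memory_system \<tau> m \<delta> A (\<lambda>t. \<delta> * A * U1 t)
    (\<lambda>t. u t - U t) (\<lambda>t. u1 t - U1 t) (\<lambda>t. u2 t - U2 t) (\<lambda>t. z t - Z t)"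
  unfolding memory_system_def
proof (intro conjI allI impI)
  fix t :: real assume t: "t > 0"
  show "((\<lambda>t. u2 t - U2 t) has_real_derivative
      - (u2 t - U2 t + A * (u t - U t) + (\<delta> + \<tau>) * A * (u1 t - U1 t) - m * A * (z t - Z t) + \<delta> * A * U1 t) / \<tau>) (at t)"
    using assms t unfolding memory_system_def
    by (auto intro!: derivative_eq_intros simp: diff_divide_distrib add_divide_distrib algebra_simps minus_divide_left[symmetric])
  show "((\<lambda>t. z t - Z t) has_real_derivative u t - U t - (z t - Z t) / \<tau>) (at t)"
    using assms t unfolding memory_system_def
    by (auto intro!: derivative_eq_intros simp: diff_divide_distrib)
qed (use assms in \<open>auto simp: memory_system_def intro!: continuous_intros derivative_intros\<close>)

text \<open>It arises from testing \<open>v'' + A (v - m z) + \<delta> A u' + h = 0\<close> with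
  \<open>v'\<close>. For the memory force, \<open>- z v' = - (z v)' + p v\<close>, and
  \<open>v = \<tau> p' + 2 p + z / \<tau>\<close> makes \<open>p v\<close> the derivative of
  \<open>(\<tau> p\<^sup>2 + z\<^sup>2 / \<tau>) / 2\<close> plus the dissipation
  \<open>2 p\<^sup>2\<close>. Likewise \<open>u' v'\<close> is the derivative of
  \<open>\<tau> u'\<^sup>2 / 2\<close> plus \<open>u'\<^sup>2\<close>, which explains the last
  term.\<close>

definition energy ::
    "real \<Rightarrow> real \<Rightarrow> real \<Rightarrow> real \<Rightarrow> real \<Rightarrow> real \<Rightarrow> real \<Rightarrow> real \<Rightarrow> real" where
  "energy \<tau> m \<delta> A u u1 u2 z =
     ((\<tau> * u2 + u1)\<^sup>2 + A * (\<tau> * u1 + u)\<^sup>2 - 2 * m * A * z * (\<tau> * u1 + u)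
       + m * A * \<tau> * (u - z / \<tau>)\<^sup>2 + m * A / \<tau> * z\<^sup>2 + \<delta> * A * \<tau> * u1\<^sup>2) / 2"

text \<open>The multiplier \<open>\<tau> v1 p1 + \<tau> A (v - m z) p\<close> produces \<open>v1\<^sup>2\<close>; the last two terms produce the
  \<open>4 p1\<^sup>2\<close> needed to absorb its error term \<open>2 v1 p1\<close>.\<close>

definition corrector ::
    "real \<Rightarrow> real \<Rightarrow> real \<Rightarrow> real \<Rightarrow> real \<Rightarrow> real \<Rightarrow> real \<Rightarrow> real" where
  "corrector \<tau> m A u u1 u2 z =
     (let v = \<tau> * u1 + u; v1 = \<tau> * u2 + u1; p = u - z / \<tau>; p1 = u1 - p / \<tau> in
       \<tau> * v1 * p1 + \<tau> * A * (v - m * z) * p + 4 * p1 * p + 4 / \<tau> * p\<^sup>2)"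

lemma DERIV_energy:
  assumes "memory_system \<tau> m \<delta> A h u u1 u2 z" "\<tau> > 0" "t > 0"
  shows "((\<lambda>t. energy \<tau> m \<delta> A (u t) (u1 t) (u2 t) (z t)) has_real_derivative
    - 2 * m * A * (u t - z t / \<tau>)\<^sup>2 - \<delta> * A * (u1 t)\<^sup>2 - h t * (\<tau> * u2 t + u1 t)) (at t)"
proof -
  have d: "(u has_real_derivative u1 t) (at t)" "(u1 has_real_derivative u2 t) (at t)"
       "(u2 has_real_derivative - (u2 t + A * u t + (\<delta> + \<tau>) * A * u1 t - m * A * z t + h t) / \<tau>) (at t)"
       "(z has_real_derivative u t - z t / \<tau>) (at t)"
    using assms unfolding memory_system_def by blast+
  show ?thesis
    unfolding energy_def using assms(2)
    by (auto intro!: derivative_eq_intros d) (simp add: field_simps power2_eq_square)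
qed

text \<open>Here \<open>p' = p1\<close> and \<open>\<tau> p1' = v1 - 2 p1 - p / \<tau>\<close>; the
  latter produces \<open>v1\<^sup>2\<close>. The elastic force in \<open>\<tau> v1' p1\<close>
  cancels against \<open>\<tau> A (v - m z) p'\<close>. In the derivative of the last two terms of
  the corrector the products \<open>p1 p\<close> cancel.\<close>

lemma DERIV_corrector:
  assumes "memory_system \<tau> m \<delta> A h u u1 u2 z" "\<tau> > 0" "t > 0"
  defines "p \<equiv> u t - z t / \<tau>" and "v1 \<equiv> \<tau> * u2 t + u1 t"
  defines "p1 \<equiv> u1 t - p / \<tau>"
  shows "((\<lambda>t. corrector \<tau> m A (u t) (u1 t) (u2 t) (z t)) has_real_derivative
    v1\<^sup>2 - 2 * v1 * p1 - v1 * p / \<tau> + \<tau> * A * v1 * p - m * \<tau> * A * p\<^sup>2 - \<delta> * \<tau> * A * u1 t * p1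
     - \<tau> * h t * p1 + 4 * p1\<^sup>2 - 4 / \<tau>\<^sup>2 * p\<^sup>2 + 4 / \<tau> * v1 * p) (at t)"
proof -
  have d: "(u has_real_derivative u1 t) (at t)" "(u1 has_real_derivative u2 t) (at t)"
       "(u2 has_real_derivative - (u2 t + A * u t + (\<delta> + \<tau>) * A * u1 t - m * A * z t + h t) / \<tau>) (at t)"
       "(z has_real_derivative u t - z t / \<tau>) (at t)"
    using assms unfolding memory_system_def by blast+
  show ?thesis
    unfolding corrector_def Let_def p1_def p_def v1_def using assms(2)
    by (auto intro!: derivative_eq_intros d) (simp add: field_simps power2_eq_square)
qed

section \<open>Differential inequalities on the half line\<close>

text \<open>The energy estimates are phrased as monotonicity of a functional instead of time
  integrals. Derivatives are available at positive times only, so continuity has to cover the time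
  0.\<close>

lemma nonincreasing_from_0:
  fixes f :: "real \<Rightarrow> real"
  assumes "continuous_on {0..} f" "t \<ge> 0"
    and "\<And>s. s > 0 \<Longrightarrow> \<exists>d. (f has_real_derivative d) (at s) \<and> d \<le> 0"
  shows "f t \<le> f 0"
  by (rule DERIV_nonpos_imp_decreasing_open) (use assms in \<open>auto intro: continuous_on_subset\<close>)

text \<open>The equation \<open>\<tau> x' + x = y\<close> makes \<open>x\<close> relax towards
  \<open>y\<close>. The function \<open>exp (s / \<tau>) * (x\<^sup>2 - S)\<close> does not
  increase, because \<open>2 x y - x\<^sup>2 \<le> y\<^sup>2 \<le> S\<close>; the initial value
  enters with a decaying factor, which is estimated by 1.\<close>

lemma relaxation_bound:
  fixes x y :: "real \<Rightarrow> real"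
  assumes \<tau>: "\<tau> > 0" and c: "continuous_on {0..} x"
    and d: "\<And>s. s > 0 \<Longrightarrow> (x has_real_derivative (y s - x s) / \<tau>) (at s)"
    and b: "\<And>s. s > 0 \<Longrightarrow> (y s)\<^sup>2 \<le> S" and t: "t \<ge> 0"
  shows "(x t)\<^sup>2 \<le> S + (x 0)\<^sup>2"
proof -
  define g where "g s = exp (s / \<tau>) * ((x s)\<^sup>2 - S)" for s
  have "g t \<le> g 0"
  proof (rule nonincreasing_from_0)
    show "continuous_on {0..} g" unfolding g_def using c \<tau> by (auto intro!: continuous_intros)
    fix s :: real assume s: "s > 0"
    have "(g has_real_derivative exp (s / \<tau>) * (2 * x s * y s - (x s)\<^sup>2 - S) / \<tau>) (at s)"
      unfolding g_def using \<tau>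
      by (auto intro!: derivative_eq_intros d s simp: field_simps power2_eq_square)
    moreover have "2 * x s * y s - (x s)\<^sup>2 - S \<le> 0"
      using b[OF s] zero_le_power2[of "x s - y s"] by (simp add: power2_diff)
    ultimately show "\<exists>d. (g has_real_derivative d) (at s) \<and> d \<le> 0"
      using \<tau> by (meson divide_nonpos_pos exp_ge_zero mult_nonneg_nonpos)
  qed (use t in simp)
  moreover have "S \<ge> 0" using b[of 1] zero_le_power2[of "y 1"] by linarith
  ultimately have "exp (t / \<tau>) * ((x t)\<^sup>2 - S) \<le> (x 0)\<^sup>2" by (simp add: g_def)
  moreover have "1 \<le> exp (t / \<tau>)" using t \<tau> by simp
  ultimately show ?thesis
    by (smt (verit) mult_le_cancel_right1 zero_le_power2)
qed

section \<open>Pointwise estimates for the energy and the corrector\<close>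

text \<open>Completing the square in \<open>z\<close> around \<open>\<tau> v\<close> leaves
  \<open>(1 - m \<tau>) A v\<^sup>2\<close>, so \<open>m \<tau> < 1\<close> turns twice the energy
  into a sum of nonnegative terms. Each bound keeps some of these terms.\<close>

lemma energy_bounds:
  fixes u u1 u2 z :: real
  assumes \<tau>: "\<tau> > 0" and m: "m > 0" and mt: "m * \<tau> < 1" and A: "A \<ge> 0" and \<delta>: "\<delta> \<ge> 0"
  defines "E \<equiv> energy \<tau> m \<delta> A u u1 u2 z"
  shows energy_nonneg: "0 \<le> E"
    and energy_v1: "(\<tau> * u2 + u1)\<^sup>2 \<le> 2 * E"
    and energy_v: "(1 - m * \<tau>) * (A * (\<tau> * u1 + u)\<^sup>2) \<le> 2 * E"
    and energy_p: "m * \<tau> * (A * (u - z / \<tau>)\<^sup>2) \<le> 2 * E"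
    and energy_elastic: "A * (\<tau> * u1 + u - m * z)\<^sup>2 \<le> 2 * E"
proof -
  define v where "v = \<tau> * u1 + u"
  have E: "2 * E = (\<tau> * u2 + u1)\<^sup>2 + (1 - m * \<tau>) * (A * v\<^sup>2) + m * \<tau> * (A * (u - z / \<tau>)\<^sup>2)
      + A * (m / \<tau> * (z - \<tau> * v)\<^sup>2) + \<delta> * A * \<tau> * u1\<^sup>2"
    unfolding E_def energy_def v_def[symmetric] using \<tau>
    by (simp add: power2_eq_square field_simps)
  have n: "0 \<le> (\<tau> * u2 + u1)\<^sup>2" "0 \<le> (1 - m * \<tau>) * (A * v\<^sup>2)" "0 \<le> m * \<tau> * (A * (u - z / \<tau>)\<^sup>2)"
     "0 \<le> A * (m / \<tau> * (z - \<tau> * v)\<^sup>2)" "0 \<le> \<delta> * A * \<tau> * u1\<^sup>2"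
    using assms by auto
  show "0 \<le> E" "(\<tau> * u2 + u1)\<^sup>2 \<le> 2 * E" "m * \<tau> * (A * (u - z / \<tau>)\<^sup>2) \<le> 2 * E" using E n by linarith+
  show "(1 - m * \<tau>) * (A * (\<tau> * u1 + u)\<^sup>2) \<le> 2 * E" using E n unfolding v_def by linarith
  \<comment> \<open>Convexity of the square with weights \<open>1 - m * \<tau>\<close> and
    \<open>m * \<tau>\<close>: \<open>v - m z\<close> is the corresponding combination of
    \<open>v\<close> and \<open>- (z - \<tau> v) / \<tau>\<close>. The right-hand side is the exact
    Jensen defect.\<close>
  have "(1 - m * \<tau>) * v\<^sup>2 + m / \<tau> * (z - \<tau> * v)\<^sup>2 - (v - m * z)\<^sup>2
      = (1 - m * \<tau>) * (m / \<tau> * z\<^sup>2)"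
    using \<tau> by (simp add: power2_eq_square field_simps)
  also have "\<dots> \<ge> 0" using \<tau> m mt by auto
  finally have "A * (v - m * z)\<^sup>2 \<le> A * ((1 - m * \<tau>) * v\<^sup>2 + m / \<tau> * (z - \<tau> * v)\<^sup>2)"
    using A by (intro mult_left_mono) auto
  also have "\<dots> \<le> 2 * E" using E n by (simp add: algebra_simps)
  finally show "A * (\<tau> * u1 + u - m * z)\<^sup>2 \<le> 2 * E" by (simp add: v_def)
qed

lemma abs_mult_le_half_squares: "\<bar>a * b\<bar> \<le> (a\<^sup>2 + b\<^sup>2) / (2::real)"
  using zero_le_power2[of "\<bar>a\<bar> - \<bar>b\<bar>"] by (simp add: power2_diff abs_mult)

text \<open>At \<open>A = 0\<close> the energy reduces to
  \<open>(\<tau> * u2 + u1)\<^sup>2 / 2\<close>, which bounds neither \<open>p\<close> nor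
  \<open>u1\<close>. This is why the corrector is multiplied by \<open>A\<close> and
  \<open>u1\<^sup>2\<close> is added on the right. Each product in the corrector is split into half
  squares.\<close>

lemma corrector_bound:
  assumes \<tau>: "\<tau> > 0" and m: "m > 0" and mt: "m * \<tau> < 1"
  obtains K where "K > 0"
    "\<And>A \<delta> u u1 u2 z. A \<ge> 0 \<Longrightarrow> \<delta> \<ge> 0 \<Longrightarrow>
      A * \<bar>corrector \<tau> m A u u1 u2 z\<bar> \<le> K * (1 + A) * (energy \<tau> m \<delta> A u u1 u2 z + u1\<^sup>2)"
proof -
  \<comment> \<open>\<open>c\<close> is the constant in \<open>A * p\<^sup>2 \<le> c * X\<close>,
    read off from the memory part of the energy. \<open>K1\<close> collects the contributions of
    \<open>v1\<^sup>2\<close> and \<open>p1\<^sup>2\<close>, \<open>K2\<close> those of the elastic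
    product, and \<open>K3\<close> the remaining \<open>p\<^sup>2\<close>.\<close>
  define c where "c = 2 / (m * \<tau>)"
  define K1 where "K1 = \<tau> + (\<tau> / 2 + 2) * (2 + 2 * c / \<tau>\<^sup>2)"
  define K2 where "K2 = \<tau> + \<tau> * c / 2"
  define K3 where "K3 = 2 * c + 4 / \<tau> * c"
  have c: "c > 0" using \<tau> m by (simp add: c_def)
  have K: "K1 > 0" "K2 > 0" "K3 > 0" using c \<tau> by (auto simp: K1_def K2_def K3_def intro!: add_pos_pos mult_pos_pos)
  show ?thesis
  proof (rule that[of "K1 + K2 + K3"])
    show "K1 + K2 + K3 > 0" using K by simp
    fix A \<delta> u u1 u2 z :: real assume A: "A \<ge> 0" and \<delta>: "\<delta> \<ge> 0"
    define E where "E = energy \<tau> m \<delta> A u u1 u2 z"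
    define v where "v = \<tau> * u1 + u"
    define v1 where "v1 = \<tau> * u2 + u1"
    define p where "p = u - z / \<tau>"
    define p1 where "p1 = u1 - p / \<tau>"
    define X where "X = E + u1\<^sup>2"
    note B = energy_bounds[OF \<tau> m mt A \<delta>, where u = u and ?u1.0 = u1 and ?u2.0 = u2 and z = z, folded E_def, folded v_def v1_def p_def]
    have X: "E \<le> X" "0 \<le> X" "u1\<^sup>2 \<le> X" using B(1) by (auto simp: X_def)
    have Ap: "A * p\<^sup>2 \<le> c * X"
    proof -
      have "A * p\<^sup>2 = (m * \<tau> * (A * p\<^sup>2)) / (m * \<tau>)" using \<tau> m by simp
      also have "\<dots> \<le> (2 * E) / (m * \<tau>)" using B(4) \<tau> m by (intro divide_right_mono) auto
      also have "\<dots> \<le> (2 * X) / (m * \<tau>)" using X \<tau> m by (intro divide_right_mono) auto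
      finally show ?thesis by (simp add: c_def)
    qed
    have XA: "X \<le> (1 + A) * X" "A * X \<le> (1 + A) * X" using X A by (auto simp: algebra_simps)
    have Ap1: "A * p1\<^sup>2 \<le> (2 + 2 * c / \<tau>\<^sup>2) * ((1 + A) * X)"
    proof -
      have "p1\<^sup>2 \<le> 2 * u1\<^sup>2 + 2 / \<tau>\<^sup>2 * p\<^sup>2"
        using zero_le_power2[of "u1 + p / \<tau>"] by (simp add: p1_def power2_diff power2_sum power_divide)
      then have "A * p1\<^sup>2 \<le> A * (2 * u1\<^sup>2 + 2 / \<tau>\<^sup>2 * p\<^sup>2)" using A by (rule mult_left_mono)
      also have "\<dots> = 2 * (A * u1\<^sup>2) + 2 / \<tau>\<^sup>2 * (A * p\<^sup>2)" by (simp add: algebra_simps)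
      also have "\<dots> \<le> 2 * (A * X) + 2 / \<tau>\<^sup>2 * (c * X)"
        using Ap X A by (intro add_mono mult_left_mono) auto
      also have "\<dots> \<le> 2 * ((1 + A) * X) + 2 / \<tau>\<^sup>2 * (c * ((1 + A) * X))"
        using XA c by (intro add_mono mult_left_mono) auto
      finally show ?thesis by (simp add: algebra_simps)
    qed
    have Av1: "A * v1\<^sup>2 \<le> 2 * ((1 + A) * X)"
    proof -
      have "A * v1\<^sup>2 \<le> A * (2 * X)" using B(2) X A by (intro mult_left_mono) auto
      then show ?thesis using XA by simp
    qed
    have Ae: "A * (A * (v - m * z)\<^sup>2) \<le> 2 * ((1 + A) * X)"
    proof -
      have "A * (A * (v - m * z)\<^sup>2) \<le> A * (2 * X)" using B(5) X A by (intro mult_left_mono) auto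
      then show ?thesis using XA by simp
    qed
    have AAp: "A * (A * p\<^sup>2) \<le> c * ((1 + A) * X)"
    proof -
      have "A * (A * p\<^sup>2) \<le> A * (c * X)" using Ap A by (rule mult_left_mono)
      also have "\<dots> = c * (A * X)" by simp
      also have "\<dots> \<le> c * ((1 + A) * X)" using XA c by (intro mult_left_mono) auto
      finally show ?thesis .
    qed
    have Ap': "A * p\<^sup>2 \<le> c * ((1 + A) * X)"
      using Ap XA(1) c by (meson less_imp_le mult_left_mono order_trans)
    have "\<bar>corrector \<tau> m A u u1 u2 z\<bar> = \<bar>\<tau> * (v1 * p1) + \<tau> * A * ((v - m * z) * p) + 4 * (p1 * p) + 4 / \<tau> * p\<^sup>2\<bar>"
      unfolding corrector_def Let_def v_def[symmetric] v1_def[symmetric] p_def[symmetric]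
        p1_def[symmetric] by (simp only: mult.assoc)
    also have "\<dots> \<le> \<tau> * \<bar>v1 * p1\<bar> + \<tau> * A * \<bar>(v - m * z) * p\<bar> + 4 * \<bar>p1 * p\<bar> + 4 / \<tau> * p\<^sup>2"
      using \<tau> A by (intro order_trans[OF abs_triangle_ineq] add_mono) (auto simp: abs_mult)
    also have "\<dots> \<le> \<tau> * ((v1\<^sup>2 + p1\<^sup>2) / 2) + \<tau> * A * (((v - m * z)\<^sup>2 + p\<^sup>2) / 2) + 4 * ((p1\<^sup>2 + p\<^sup>2) / 2)
         + 4 / \<tau> * p\<^sup>2"
      using \<tau> A by (intro add_mono mult_left_mono abs_mult_le_half_squares) auto
    finally have "A * \<bar>corrector \<tau> m A u u1 u2 z\<bar> \<le> A * (\<tau> * ((v1\<^sup>2 + p1\<^sup>2) / 2) + \<tau> * A * (((v - m * z)\<^sup>2 + p\<^sup>2) / 2) + 4 * ((p1\<^sup>2 + p\<^sup>2) / 2)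
         + 4 / \<tau> * p\<^sup>2)" using A by (rule mult_left_mono)
    also have "\<dots> = \<tau> / 2 * (A * v1\<^sup>2) + (\<tau> / 2 + 2) * (A * p1\<^sup>2) + \<tau> / 2 * (A * (A * (v - m * z)\<^sup>2))
        + \<tau> / 2 * (A * (A * p\<^sup>2)) + (2 + 4 / \<tau>) * (A * p\<^sup>2)"
      by (simp add: algebra_simps add_divide_distrib)
    also have "\<dots> \<le> \<tau> / 2 * (2 * ((1 + A) * X)) + (\<tau> / 2 + 2) * ((2 + 2 * c / \<tau>\<^sup>2) * ((1 + A) * X))
        + \<tau> / 2 * (2 * ((1 + A) * X)) + \<tau> / 2 * (c * ((1 + A) * X)) + (2 + 4 / \<tau>) * (c * ((1 + A) * X))"
      using \<tau> by (intro add_mono mult_left_mono Av1 Ap1 Ae AAp Ap') auto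
    also have "\<dots> = (K1 + K2 + K3) * (1 + A) * X"
      by (simp add: K1_def K2_def K3_def algebra_simps add_divide_distrib)
    finally show "A * \<bar>corrector \<tau> m A u u1 u2 z\<bar> \<le> (K1 + K2 + K3) * (1 + A) * (energy \<tau> m \<delta> A u u1 u2 z + u1\<^sup>2)"
      by (simp add: X_def E_def)
  qed
qed

text \<open>The error \<open>2 v1 p1\<close> costs \<open>v1\<^sup>2 / 4\<close> and exactly the
  available \<open>4 p1\<^sup>2\<close>; the \<open>v1 p\<close> terms cost another
  \<open>v1\<^sup>2 / 4\<close>, so half of \<open>v1\<^sup>2\<close> survives. The rest involves
  \<open>p\<^sup>2\<close> and \<open>\<delta> u1\<^sup>2\<close> and is paid by the energy
  dissipation. The coefficient of \<open>p\<^sup>2\<close> is quadratic in \<open>A\<close>, hence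
  the weight \<open>(1 + A)\<^sup>2\<close> and eventually the loss of two derivatives.\<close>

lemma corrector_dissipation:
  fixes \<tau> m :: real
  assumes \<tau>: "\<tau> > 0" and m: "m > 0"
  obtains K where "K > 0"
   "\<And>A \<delta> u1 v1 p p1. A \<ge> 0 \<Longrightarrow> 0 \<le> \<delta> \<Longrightarrow> \<delta> \<le> 1 \<Longrightarrow> p1 = u1 - p / \<tau> \<Longrightarrow>
      A * v1\<^sup>2 / 2 \<le> A * (v1\<^sup>2 - 2 * v1 * p1 - v1 * p / \<tau> + \<tau> * A * v1 * p - m * \<tau> * A * p\<^sup>2
        - \<delta> * \<tau> * A * u1 * p1 + 4 * p1\<^sup>2 - 4 / \<tau>\<^sup>2 * p\<^sup>2 + 4 / \<tau> * v1 * p)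
       + K * (1 + A)\<^sup>2 * (2 * m * A * p\<^sup>2 + \<delta> * A * u1\<^sup>2)"
proof -
  define K1 where "K1 = 4 / \<tau>\<^sup>2 + (3 / \<tau> + \<tau>)\<^sup>2 + m * \<tau> + 1"
  have K1: "K1 > 0" using \<tau> m by (auto simp: K1_def intro!: add_nonneg_pos add_nonneg_nonneg)
  show ?thesis
  proof (rule that[of "K1 / (2 * m) + (\<tau> + 1)"])
    show "K1 / (2 * m) + (\<tau> + 1) > 0" using K1 \<tau> m by (auto intro!: add_pos_pos)
    fix A \<delta> u1 v1 p p1 :: real assume A: "A \<ge> 0" and \<delta>: "0 \<le> \<delta>" "\<delta> \<le> 1" and p1: "p1 = u1 - p / \<tau>"
    \<comment> \<open>\<open>B\<close> is the total coefficient of \<open>v1 * p\<close>, with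
      \<open>3 / \<tau> = 4 / \<tau> - 1 / \<tau>\<close>. \<open>R\<close> gathers what multiplies
      \<open>p\<^sup>2\<close> after the estimates \<open>a2\<close> and \<open>a3\<close>; it will
      be bounded by \<open>K1 * (1 + A)\<^sup>2\<close>.\<close>
    define B where "B = 3 / \<tau> + \<tau> * A"
    define R where "R = 4 / \<tau>\<^sup>2 + B\<^sup>2 + m * \<tau> * A + A"
    define S where "S = v1\<^sup>2 - 2 * v1 * p1 - v1 * p / \<tau> + \<tau> * A * v1 * p - m * \<tau> * A * p\<^sup>2
        - \<delta> * \<tau> * A * u1 * p1 + 4 * p1\<^sup>2 - 4 / \<tau>\<^sup>2 * p\<^sup>2 + 4 / \<tau> * v1 * p"
    have a1: "2 * v1 * p1 \<le> v1\<^sup>2 / 4 + 4 * p1\<^sup>2"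
      using zero_le_power2[of "v1 / 2 - 2 * p1"] by (simp add: power2_diff power_divide power_mult_distrib)
    have a2: "\<bar>B * v1 * p\<bar> \<le> v1\<^sup>2 / 4 + B\<^sup>2 * p\<^sup>2"
      using abs_mult_le_half_squares[of "v1 / sqrt 2" "sqrt 2 * (B * p)"]
      by (simp add: power_divide power_mult_distrib mult.commute mult.left_commute)
    \<comment> \<open>Substituting \<open>p1 = u1 - p / \<tau>\<close> gives
      \<open>\<delta> \<tau> A u1\<^sup>2 - \<delta> A u1 p\<close>. Only the square
      \<open>p\<^sup>2\<close> from the mixed term loses its factor \<open>\<delta>\<close>, by
      \<open>\<delta> \<le> 1\<close>.\<close>
    have a3: "\<delta> * \<tau> * A * u1 * p1 \<le> (\<tau> + 1) * (\<delta> * A * u1\<^sup>2) + A * p\<^sup>2"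
    proof -
      have "- (u1 * p) \<le> u1\<^sup>2 + p\<^sup>2"
        using zero_le_power2[of "u1 + p"] zero_le_power2[of u1] zero_le_power2[of p]
        unfolding power2_sum by linarith
      then have "\<delta> * A * (- (u1 * p)) \<le> \<delta> * A * (u1\<^sup>2 + p\<^sup>2)" using A \<delta> by (intro mult_left_mono) auto
      moreover have "\<delta> * (A * p\<^sup>2) \<le> A * p\<^sup>2" using A \<delta> by (intro mult_left_le_one_le) auto
      ultimately show ?thesis using \<tau> by (simp add: p1 algebra_simps power2_eq_square)
    qed
    have "S = v1\<^sup>2 - 2 * v1 * p1 + B * v1 * p - m * \<tau> * A * p\<^sup>2
        - \<delta> * \<tau> * A * u1 * p1 + 4 * p1\<^sup>2 - 4 / \<tau>\<^sup>2 * p\<^sup>2"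
      using \<tau> by (simp add: S_def B_def field_simps)
    then have "v1\<^sup>2 / 2 \<le> S + (4 / \<tau>\<^sup>2 * p\<^sup>2 + B\<^sup>2 * p\<^sup>2 + m * \<tau> * A * p\<^sup>2 + A * p\<^sup>2) + (\<tau> + 1) * (\<delta> * A * u1\<^sup>2)"
      using a1 a2 a3 by linarith
    then have "v1\<^sup>2 / 2 \<le> S + (R * p\<^sup>2 + (\<tau> + 1) * (\<delta> * A * u1\<^sup>2))"
      by (simp add: R_def algebra_simps)
    then have "A * (v1\<^sup>2 / 2) \<le> A * (S + (R * p\<^sup>2 + (\<tau> + 1) * (\<delta> * A * u1\<^sup>2)))"
      using A by (rule mult_left_mono)
    also have "\<dots> = A * S + (R * (A * p\<^sup>2) + A * ((\<tau> + 1) * (\<delta> * A * u1\<^sup>2)))"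
      by (simp add: algebra_simps)
    also have "\<dots> \<le> A * S + (K1 * (1 + A)\<^sup>2 * (A * p\<^sup>2) + (1 + A)\<^sup>2 * ((\<tau> + 1) * (\<delta> * A * u1\<^sup>2)))"
    proof -
      have a4: "(1 + A)\<^sup>2 \<ge> 1" "(1 + A)\<^sup>2 \<ge> A"
        using A by (auto simp: power2_eq_square algebra_simps)
      have "(3 / \<tau> + \<tau>) * (1 + A) = B + (\<tau> + 3 / \<tau> * A)" by (simp add: B_def algebra_simps add_divide_distrib)
      then have "B \<le> (3 / \<tau> + \<tau>) * (1 + A)" "0 \<le> B" using \<tau> A by (auto simp: B_def)
      then have "B\<^sup>2 \<le> (3 / \<tau> + \<tau>)\<^sup>2 * (1 + A)\<^sup>2"
        unfolding power_mult_distrib[symmetric] by (intro power_mono)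
      moreover have "4 / \<tau>\<^sup>2 * 1 \<le> 4 / \<tau>\<^sup>2 * (1 + A)\<^sup>2" using a4 by (intro mult_left_mono) auto
      moreover have "m * \<tau> * A \<le> m * \<tau> * (1 + A)\<^sup>2" using a4 m \<tau> by (intro mult_left_mono) auto
      ultimately have "R \<le> K1 * (1 + A)\<^sup>2" using a4 by (simp add: R_def K1_def algebra_simps)
      then show ?thesis using a4 A \<delta> \<tau> by (intro add_left_mono add_mono mult_right_mono) auto
    qed
    \<comment> \<open>Adding the two constants lets one multiple of the full energy dissipation
      cover both terms; the extra cross terms are nonnegative.\<close>
    also have "\<dots> \<le> A * S + (K1 / (2 * m) + (\<tau> + 1)) * (1 + A)\<^sup>2 * (2 * m * A * p\<^sup>2 + \<delta> * A * u1\<^sup>2)"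
    proof -
      have "(K1 / (2 * m) + (\<tau> + 1)) * (1 + A)\<^sup>2 * (2 * m * A * p\<^sup>2 + \<delta> * A * u1\<^sup>2)
         = (K1 * (1 + A)\<^sup>2 * (A * p\<^sup>2) + (1 + A)\<^sup>2 * ((\<tau> + 1) * (\<delta> * A * u1\<^sup>2)))
          + (K1 / (2 * m) * (1 + A)\<^sup>2 * (\<delta> * A * u1\<^sup>2) + (\<tau> + 1) * (1 + A)\<^sup>2 * (2 * m * A * p\<^sup>2))"
        using m by (simp add: field_simps)
      moreover have "0 \<le> K1 / (2 * m) * (1 + A)\<^sup>2 * (\<delta> * A * u1\<^sup>2) + (\<tau> + 1) * (1 + A)\<^sup>2 * (2 * m * A * p\<^sup>2)"
        using K1 m \<tau> A \<delta> by (intro add_nonneg_nonneg mult_nonneg_nonneg) auto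
      ultimately show ?thesis by linarith
    qed
    finally show "A * v1\<^sup>2 / 2 \<le> A * (v1\<^sup>2 - 2 * v1 * p1 - v1 * p / \<tau> + \<tau> * A * v1 * p - m * \<tau> * A * p\<^sup>2
        - \<delta> * \<tau> * A * u1 * p1 + 4 * p1\<^sup>2 - 4 / \<tau>\<^sup>2 * p\<^sup>2 + 4 / \<tau> * v1 * p)
       + (K1 / (2 * m) + (\<tau> + 1)) * (1 + A)\<^sup>2 * (2 * m * A * p\<^sup>2 + \<delta> * A * u1\<^sup>2)"
      by (simp add: S_def)
  qed
qed

text \<open>The memory starts at zero. The bounds \<open>m \<tau> < 1\<close> and
  \<open>\<delta> \<le> 1\<close> make the constant uniform in \<open>\<delta>\<close>, and the
  power of \<open>A\<close> matches data with one more derivative on the first two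
  components.\<close>

lemma energy_initial_bound:
  assumes \<tau>: "\<tau> > 0" and m: "m > 0" and mt: "m * \<tau> < 1"
  obtains K where "K > 0"
    "\<And>A \<delta> a b c. A \<ge> 0 \<Longrightarrow> 0 \<le> \<delta> \<Longrightarrow> \<delta> \<le> 1 \<Longrightarrow>
      energy \<tau> m \<delta> A a b c 0 \<le> K * ((1 + A) * (a\<^sup>2 + b\<^sup>2) + c\<^sup>2)"
proof (rule that[of "\<tau>\<^sup>2 + \<tau> + 3"])
  show "\<tau>\<^sup>2 + \<tau> + 3 > 0" using \<tau> by (auto intro: add_nonneg_pos)
  fix A \<delta> a b c :: real assume A: "A \<ge> 0" and \<delta>: "0 \<le> \<delta>" "\<delta> \<le> 1"
  have "(\<tau> * c + b)\<^sup>2 \<le> 2 * \<tau>\<^sup>2 * c\<^sup>2 + 2 * b\<^sup>2"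
    using zero_le_power2[of "\<tau> * c - b"] by (simp add: power2_diff power2_sum power_mult_distrib)
  moreover have "(\<tau> * b + a)\<^sup>2 \<le> 2 * \<tau>\<^sup>2 * b\<^sup>2 + 2 * a\<^sup>2"
    using zero_le_power2[of "\<tau> * b - a"] by (simp add: power2_diff power2_sum power_mult_distrib)
  then have "A * (\<tau> * b + a)\<^sup>2 \<le> A * (2 * \<tau>\<^sup>2 * b\<^sup>2 + 2 * a\<^sup>2)" using A by (rule mult_left_mono)
  moreover have "(m * \<tau>) * (A * a\<^sup>2) \<le> 1 * (A * a\<^sup>2)" using A mt by (intro mult_right_mono) auto
  moreover have "\<delta> * (A * \<tau> * b\<^sup>2) \<le> 1 * (A * \<tau> * b\<^sup>2)" using A \<delta> \<tau> by (intro mult_right_mono) auto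
  ultimately have "2 * energy \<tau> m \<delta> A a b c 0 \<le> 2 * \<tau>\<^sup>2 * c\<^sup>2 + 2 * b\<^sup>2 + A * (2 * \<tau>\<^sup>2 * b\<^sup>2 + 2 * a\<^sup>2)
     + A * a\<^sup>2 + A * \<tau> * b\<^sup>2"
    unfolding energy_def by (simp add: algebra_simps)
  moreover have "0 \<le> \<tau>\<^sup>2 * a\<^sup>2" "0 \<le> \<tau>\<^sup>2 * b\<^sup>2" "0 \<le> \<tau> * a\<^sup>2" "0 \<le> \<tau> * b\<^sup>2" "0 \<le> \<tau> * c\<^sup>2"
    "0 \<le> A * (\<tau>\<^sup>2 * a\<^sup>2)" "0 \<le> A * (\<tau>\<^sup>2 * b\<^sup>2)" "0 \<le> A * (\<tau> * a\<^sup>2)" "0 \<le> A * (\<tau> * b\<^sup>2)" "0 \<le> A * a\<^sup>2" "0 \<le> A * b\<^sup>2"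
    "0 \<le> a\<^sup>2" "0 \<le> b\<^sup>2" "0 \<le> c\<^sup>2"
    using A \<tau> by simp_all
  ultimately show "energy \<tau> m \<delta> A a b c 0 \<le> (\<tau>\<^sup>2 + \<tau> + 3) * ((1 + A) * (a\<^sup>2 + b\<^sup>2) + c\<^sup>2)"
    by (simp only: algebra_simps)
qed

section \<open>Estimates along solutions\<close>

lemma continuous_on_energy:
  assumes "memory_system \<tau> m \<delta> A h u u1 u2 z" "\<tau> > 0"
  shows "continuous_on {0..} (\<lambda>t. energy \<tau> m \<delta> A (u t) (u1 t) (u2 t) (z t))"
  using assms unfolding memory_system_def energy_def by (auto intro!: continuous_intros)

lemma continuous_on_corrector:
  assumes "memory_system \<tau> m \<delta> A h u u1 u2 z" "\<tau> > 0"
  shows "continuous_on {0..} (\<lambda>t. corrector \<tau> m A (u t) (u1 t) (u2 t) (z t))"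
  using assms unfolding memory_system_def corrector_def Let_def by (auto intro!: continuous_intros)

lemma energy_le_initial:
  assumes s: "memory_system \<tau> m \<delta> A (\<lambda>t. 0) u u1 u2 z" and p: "\<tau> > 0" "m > 0" "A \<ge> 0" "\<delta> \<ge> 0" "t \<ge> 0"
  shows "energy \<tau> m \<delta> A (u t) (u1 t) (u2 t) (z t) \<le> energy \<tau> m \<delta> A (u 0) (u1 0) (u2 0) 0"
proof -
  have z: "z 0 = 0" using s by (simp add: memory_system_def)
  have "energy \<tau> m \<delta> A (u t) (u1 t) (u2 t) (z t) \<le> energy \<tau> m \<delta> A (u 0) (u1 0) (u2 0) (z 0)"
  proof (rule nonincreasing_from_0[OF continuous_on_energy[OF s p(1)] p(5)])
    fix r :: real assume r: "r > 0"
    have "- 2 * m * A * (u r - z r / \<tau>)\<^sup>2 - \<delta> * A * (u1 r)\<^sup>2 - 0 * (\<tau> * u2 r + u1 r) \<le> 0"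
    proof -
      have "0 \<le> m * A * (u r - z r / \<tau>)\<^sup>2" "0 \<le> \<delta> * A * (u1 r)\<^sup>2" using p by auto
      then show ?thesis by linarith
    qed
    then show "\<exists>d. ((\<lambda>t. energy \<tau> m \<delta> A (u t) (u1 t) (u2 t) (z t)) has_real_derivative d) (at r) \<and> d \<le> 0"
      using DERIV_energy[OF s p(1) r] by blast
  qed
  then show ?thesis by (simp only: z)
qed

text \<open>This recovers \<open>u1\<close> from the energy bound on \<open>\<tau> * u2 + u1\<close>
  uniformly in time, also at low frequencies.\<close>

lemma memory_system_u1_bound:
  assumes s: "memory_system \<tau> m \<delta> A h u u1 u2 z" and "\<tau> > 0" "t \<ge> 0"
    and "\<And>s. s > 0 \<Longrightarrow> (\<tau> * u2 s + u1 s)\<^sup>2 \<le> S"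
  shows "(u1 t)\<^sup>2 \<le> S + (u1 0)\<^sup>2"
  by (rule relaxation_bound[where y = "\<lambda>s. \<tau> * u2 s + u1 s" and \<tau> = \<tau>])
     (use assms in \<open>auto simp: memory_system_def\<close>)

lemma memory_system_u_bound:
  assumes s: "memory_system \<tau> m \<delta> A h u u1 u2 z" and "\<tau> > 0" "t \<ge> 0"
    and "\<And>s. s > 0 \<Longrightarrow> (\<tau> * u1 s + u s)\<^sup>2 \<le> S"
  shows "(u t)\<^sup>2 \<le> S + (u 0)\<^sup>2"
  by (rule relaxation_bound[where y = "\<lambda>s. \<tau> * u1 s + u s" and \<tau> = \<tau>])
     (use assms in \<open>auto simp: memory_system_def\<close>)

text \<open>A derivative-only form of \<open>A \<integral> (\<tau> u2 + u1)\<^sup>2 \<le> 2 K (1 + A)\<^sup>2 D\<close>, with \<open>D\<close> quadratic in the data.\<close>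

lemma dissipation_functional:
  fixes \<tau> m :: real
  assumes \<tau>: "\<tau> > 0" and m: "m > 0" and mt: "m * \<tau> < 1"
  obtains K where "K > 0"
    "\<And>A \<delta> u u1 u2 z. A \<ge> 0 \<Longrightarrow> 0 \<le> \<delta> \<Longrightarrow> \<delta> \<le> 1 \<Longrightarrow> memory_system \<tau> m \<delta> A (\<lambda>t. 0) u u1 u2 z \<Longrightarrow>
      \<exists>N. continuous_on {0..} N \<and>
        (\<forall>t>0. \<exists>d. (N has_real_derivative d) (at t) \<and> d \<le> - (A * (\<tau> * u2 t + u1 t)\<^sup>2)) \<and>
        (\<forall>t\<ge>0. \<bar>N t\<bar> \<le> K * (1 + A)\<^sup>2 * ((1 + A) * ((u 0)\<^sup>2 + (u1 0)\<^sup>2) + (u2 0)\<^sup>2))"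
proof -
  obtain Kc where Kc: "Kc > 0" "\<And>A \<delta> u u1 u2 z. A \<ge> 0 \<Longrightarrow> \<delta> \<ge> 0 \<Longrightarrow>
      A * \<bar>corrector \<tau> m A u u1 u2 z\<bar> \<le> Kc * (1 + A) * (energy \<tau> m \<delta> A u u1 u2 z + u1\<^sup>2)"
    using corrector_bound[OF \<tau> m mt] by metis
  obtain Kd where Kd: "Kd > 0"
   "\<And>A \<delta> u1 v1 p p1. A \<ge> 0 \<Longrightarrow> 0 \<le> \<delta> \<Longrightarrow> \<delta> \<le> 1 \<Longrightarrow> p1 = u1 - p / \<tau> \<Longrightarrow>
      A * v1\<^sup>2 / 2 \<le> A * (v1\<^sup>2 - 2 * v1 * p1 - v1 * p / \<tau> + \<tau> * A * v1 * p - m * \<tau> * A * p\<^sup>2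
        - \<delta> * \<tau> * A * u1 * p1 + 4 * p1\<^sup>2 - 4 / \<tau>\<^sup>2 * p\<^sup>2 + 4 / \<tau> * v1 * p)
       + Kd * (1 + A)\<^sup>2 * (2 * m * A * p\<^sup>2 + \<delta> * A * u1\<^sup>2)"
    using corrector_dissipation[OF \<tau> m] by metis
  obtain Ki where Ki: "Ki > 0"
    "\<And>A \<delta> a b c. A \<ge> 0 \<Longrightarrow> 0 \<le> \<delta> \<Longrightarrow> \<delta> \<le> 1 \<Longrightarrow>
      energy \<tau> m \<delta> A a b c 0 \<le> Ki * ((1 + A) * (a\<^sup>2 + b\<^sup>2) + c\<^sup>2)"
    using energy_initial_bound[OF \<tau> m mt] by metis
  define K where "K = 2 * Kd * Ki + 2 * Kc * (3 * Ki + 1)"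
  show ?thesis
  proof (rule that[of K])
    show "K > 0" using Kc(1) Kd(1) Ki(1) by (auto simp: K_def intro!: add_pos_pos)
    fix A \<delta> :: real and u u1 u2 z
    assume A: "A \<ge> 0" and \<delta>: "0 \<le> \<delta>" "\<delta> \<le> 1" and s: "memory_system \<tau> m \<delta> A (\<lambda>t. 0) u u1 u2 z"
    define E where "E t = energy \<tau> m \<delta> A (u t) (u1 t) (u2 t) (z t)" for t
    define M where "M t = corrector \<tau> m A (u t) (u1 t) (u2 t) (z t)" for t
    \<comment> \<open>The corrector enters with a negative sign, so that its derivative supplies
      \<open>- A v1\<^sup>2\<close>. The weight on the energy is chosen so that its dissipation
      dominates the error terms of the corrector.\<close>
    define N where "N t = 2 * Kd * (1 + A)\<^sup>2 * E t - 2 * A * M t" for t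
    define D where "D = (1 + A) * ((u 0)\<^sup>2 + (u1 0)\<^sup>2) + (u2 0)\<^sup>2"
    have Eb: "E t \<le> Ki * D" "0 \<le> E t" "(\<tau> * u2 t + u1 t)\<^sup>2 \<le> 2 * Ki * D" if "t \<ge> 0" for t
    proof -
      show 1: "E t \<le> Ki * D"
        using energy_le_initial[OF s \<tau> m A \<delta>(1) that] Ki(2)[OF A \<delta>] unfolding E_def D_def
        by (rule order_trans)
      show "0 \<le> E t" unfolding E_def by (rule energy_nonneg[OF \<tau> m mt A \<delta>(1)])
      show "(\<tau> * u2 t + u1 t)\<^sup>2 \<le> 2 * Ki * D"
        using energy_v1[OF \<tau> m mt A \<delta>(1), of "u2 t" "u1 t" "u t" "z t"] 1 unfolding E_def by simp
    qed
    have D0: "D \<ge> 0" using A by (simp add: D_def)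
    \<comment> \<open>This supplies the additional \<open>u1\<^sup>2\<close> in the corrector
      bound.\<close>
    have ub: "(u1 t)\<^sup>2 \<le> (2 * Ki + 1) * D" if t: "t \<ge> 0" for t
    proof -
      have "(u1 t)\<^sup>2 \<le> 2 * Ki * D + (u1 0)\<^sup>2"
        by (rule memory_system_u1_bound[OF s \<tau> t]) (use Eb in auto)
      moreover have "(u1 0)\<^sup>2 \<le> D" using A by (simp add: D_def algebra_simps)
      ultimately show ?thesis by (simp add: algebra_simps)
    qed
    have "continuous_on {0..} N" unfolding N_def E_def M_def
      by (intro continuous_intros continuous_on_energy[OF s \<tau>] continuous_on_corrector[OF s \<tau>])
    moreover have "\<exists>d. (N has_real_derivative d) (at t) \<and> d \<le> - (A * (\<tau> * u2 t + u1 t)\<^sup>2)" if t: "t > 0" for t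
    proof -
      define p where "p = u t - z t / \<tau>"
      define v1 where "v1 = \<tau> * u2 t + u1 t"
      define p1 where "p1 = u1 t - p / \<tau>"
      define M' where "M' = v1\<^sup>2 - 2 * v1 * p1 - v1 * p / \<tau> + \<tau> * A * v1 * p - m * \<tau> * A * p\<^sup>2 - \<delta> * \<tau> * A * u1 t * p1
     + 4 * p1\<^sup>2 - 4 / \<tau>\<^sup>2 * p\<^sup>2 + 4 / \<tau> * v1 * p"
      have "(E has_real_derivative - (2 * m * A * p\<^sup>2 + \<delta> * A * (u1 t)\<^sup>2)) (at t)"
        using DERIV_energy[OF s \<tau> t] unfolding E_def p_def by simp
      moreover have "(M has_real_derivative M') (at t)"
        using DERIV_corrector[OF s \<tau> t] unfolding M_def M'_def p_def v1_def p1_def by simp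
      ultimately have "(N has_real_derivative 2 * Kd * (1 + A)\<^sup>2 * - (2 * m * A * p\<^sup>2 + \<delta> * A * (u1 t)\<^sup>2) - 2 * A * M') (at t)"
        unfolding N_def by (intro derivative_intros DERIV_cmult)
      moreover have N': "A * v1\<^sup>2 / 2 \<le> A * M' + Kd * (1 + A)\<^sup>2 * (2 * m * A * p\<^sup>2 + \<delta> * A * (u1 t)\<^sup>2)"
        unfolding M'_def by (rule Kd(2)[OF A \<delta> p1_def])
      moreover from N' have "2 * Kd * (1 + A)\<^sup>2 * - (2 * m * A * p\<^sup>2 + \<delta> * A * (u1 t)\<^sup>2) - 2 * A * M' \<le> - (A * v1\<^sup>2)"
        by (simp add: algebra_simps)
      ultimately show ?thesis unfolding v1_def by blast
    qed
    moreover have "\<bar>N t\<bar> \<le> K * (1 + A)\<^sup>2 * D" if t: "t \<ge> 0" for t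
    proof -
      have "\<bar>N t\<bar> \<le> 2 * Kd * (1 + A)\<^sup>2 * E t + 2 * (A * \<bar>M t\<bar>)"
      proof -
        have "\<bar>N t\<bar> \<le> \<bar>2 * Kd * (1 + A)\<^sup>2 * E t\<bar> + \<bar>2 * A * M t\<bar>"
          unfolding N_def by (rule abs_triangle_ineq4)
        then show ?thesis using Kd(1) A Eb(2)[OF t] by (simp add: abs_mult)
      qed
      also have "\<dots> \<le> 2 * Kd * (1 + A)\<^sup>2 * E t + 2 * (Kc * (1 + A) * (E t + (u1 t)\<^sup>2))"
        using Kc(2)[OF A \<delta>(1)] unfolding E_def M_def by simp
      also have "\<dots> \<le> 2 * Kd * (1 + A)\<^sup>2 * (Ki * D) + 2 * (Kc * (1 + A)\<^sup>2 * (Ki * D + (2 * Ki + 1) * D))"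
      proof -
        have "1 + A \<le> (1 + A)\<^sup>2" using A by (simp add: power2_eq_square algebra_simps)
        then show ?thesis using Kd Kc Eb(1,2)[OF t] ub[OF t] A
          by (intro add_mono mult_left_mono mult_mono) auto
      qed
      also have "\<dots> = K * (1 + A)\<^sup>2 * D" by (simp add: K_def algebra_simps)
      finally show ?thesis .
    qed
    ultimately show "\<exists>N. continuous_on {0..} N \<and>
        (\<forall>t>0. \<exists>d. (N has_real_derivative d) (at t) \<and> d \<le> - (A * (\<tau> * u2 t + u1 t)\<^sup>2)) \<and>
        (\<forall>t\<ge>0. \<bar>N t\<bar> \<le> K * (1 + A)\<^sup>2 * ((1 + A) * ((u 0)\<^sup>2 + (u1 0)\<^sup>2) + (u2 0)\<^sup>2))"
      unfolding D_def by blast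
  qed
qed

text \<open>The energy of the difference starts at zero and grows at most by the work
  \<open>- \<delta> A U1 v1\<close> of the source. By Young's inequality and
  \<open>v1 = vu - vU\<close> this work is controlled by \<open>\<delta> A\<close> times the squares
  of \<open>U1\<close>, \<open>vu\<close> and \<open>vU\<close>. The dissipation functionals of the
  two solutions have bounded total decrease and pay for \<open>vu\<close> and \<open>vU\<close>, so
  no growth in time occurs.\<close>

lemma memory_system_difference_bound:
  fixes \<tau> m :: real
  assumes \<tau>: "\<tau> > 0" and m: "m > 0" and mt: "m * \<tau> < 1"
  obtains K where "K > 0"
    "\<And>A \<delta> u u1 u2 z U U1 U2 Z t. A \<ge> 0 \<Longrightarrow> 0 \<le> \<delta> \<Longrightarrow> \<delta> \<le> 1 \<Longrightarrow>
      memory_system \<tau> m \<delta> A (\<lambda>t. 0) u u1 u2 z \<Longrightarrow> memory_system \<tau> m 0 A (\<lambda>t. 0) U U1 U2 Z \<Longrightarrow>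
      u 0 = U 0 \<Longrightarrow> u1 0 = U1 0 \<Longrightarrow> u2 0 = U2 0 \<Longrightarrow> t \<ge> 0 \<Longrightarrow>
      (\<tau> * (u2 t - U2 t) + (u1 t - U1 t))\<^sup>2 + A * (\<tau> * (u1 t - U1 t) + (u t - U t))\<^sup>2
        + (u1 t - U1 t)\<^sup>2 + A * (u t - U t)\<^sup>2
      \<le> K * \<delta> * (1 + A)\<^sup>2 * ((1 + A) * ((U 0)\<^sup>2 + (U1 0)\<^sup>2) + (U2 0)\<^sup>2)"
proof -
  obtain K where K: "K > 0"
    "\<And>A \<delta> u u1 u2 z. A \<ge> 0 \<Longrightarrow> 0 \<le> \<delta> \<Longrightarrow> \<delta> \<le> 1 \<Longrightarrow> memory_system \<tau> m \<delta> A (\<lambda>t. 0) u u1 u2 z \<Longrightarrow>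
      \<exists>N. continuous_on {0..} N \<and>
        (\<forall>t>0. \<exists>d. (N has_real_derivative d) (at t) \<and> d \<le> - (A * (\<tau> * u2 t + u1 t)\<^sup>2)) \<and>
        (\<forall>t\<ge>0. \<bar>N t\<bar> \<le> K * (1 + A)\<^sup>2 * ((1 + A) * ((u 0)\<^sup>2 + (u1 0)\<^sup>2) + (u2 0)\<^sup>2))"
    using dissipation_functional[OF \<tau> m mt] by metis
  \<comment> \<open>Of the four squares in the conclusion, two are bounded by \<open>X\<close> and
    two by \<open>X / (1 - m * \<tau>)\<close>.\<close>
  define c where "c = 2 + 2 / (1 - m * \<tau>)"
  have c: "c > 0" using mt by (auto simp: c_def intro!: add_pos_pos)
  \<comment> \<open>Each functional varies by at most twice its bound \<open>K * D\<close>. With the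
    weights 3 and 2 and the prefactor \<open>\<delta> / 2\<close> this gives \<open>5 * K\<close>;
    the initial value of \<open>\<tau> * A * U1\<^sup>2\<close> contributes the
    \<open>\<tau>\<close>.\<close>
  define C where "C = 2 * c * (5 * K + \<tau>)"
  show ?thesis
  proof (rule that[of C])
    show "C > 0" using c K \<tau> by (auto simp: C_def intro!: add_pos_pos)
    fix A \<delta> t :: real and u u1 u2 z U U1 U2 Z
    assume A: "A \<ge> 0" and \<delta>: "0 \<le> \<delta>" "\<delta> \<le> 1"
      and s: "memory_system \<tau> m \<delta> A (\<lambda>t. 0) u u1 u2 z" and S: "memory_system \<tau> m 0 A (\<lambda>t. 0) U U1 U2 Z"
      and init: "u 0 = U 0" "u1 0 = U1 0" "u2 0 = U2 0" and t: "t \<ge> 0"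
    define D where "D = (1 + A)\<^sup>2 * ((1 + A) * ((U 0)\<^sup>2 + (U1 0)\<^sup>2) + (U2 0)\<^sup>2)"
    obtain N where N: "continuous_on {0..} N"
        "\<And>t. t > 0 \<Longrightarrow> \<exists>d. (N has_real_derivative d) (at t) \<and> d \<le> - (A * (\<tau> * u2 t + u1 t)\<^sup>2)"
        "\<And>t. t \<ge> 0 \<Longrightarrow> \<bar>N t\<bar> \<le> K * D"
      using K(2)[OF A \<delta> s] init unfolding D_def by (auto simp: mult.assoc)
    obtain N0 where N0: "continuous_on {0..} N0"
        "\<And>t. t > 0 \<Longrightarrow> \<exists>d. (N0 has_real_derivative d) (at t) \<and> d \<le> - (A * (\<tau> * U2 t + U1 t)\<^sup>2)"
        "\<And>t. t \<ge> 0 \<Longrightarrow> \<bar>N0 t\<bar> \<le> K * D"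
      using K(2)[OF A _ _ S] unfolding D_def by (auto simp: mult.assoc)
    define w w1 w2 y where "w t = u t - U t" and "w1 t = u1 t - U1 t"
      and "w2 t = u2 t - U2 t" and "y t = z t - Z t" for t
    have sw: "memory_system \<tau> m \<delta> A (\<lambda>t. \<delta> * A * U1 t) w w1 w2 y"
      using memory_system_diff[OF s S] unfolding w_def w1_def w2_def y_def .
    define E where "E t = energy \<tau> m \<delta> A (w t) (w1 t) (w2 t) (y t)" for t
    \<comment> \<open>The term in \<open>U1\<close> accounts for \<open>\<integral> U1\<^sup>2\<close>, because \<open>\<tau> U2 + U1 = vU\<close>
      gives \<open>\<tau> (U1\<^sup>2)' \<le> vU\<^sup>2 - U1\<^sup>2\<close>.\<close>
    define Q where "Q t = E t + \<delta> / 2 * (\<tau> * A * (U1 t)\<^sup>2 + 3 * N0 t + 2 * N t)" for t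
    have w0: "w 0 = 0" "w1 0 = 0" "w2 0 = 0" "y 0 = 0"
      using init s S by (auto simp: w_def w1_def w2_def y_def memory_system_def)
    have mono: "Q t \<le> Q 0" if "t \<ge> 0" for t
    proof (rule nonincreasing_from_0[OF _ that])
      have "continuous_on {0..} E" unfolding E_def by (rule continuous_on_energy[OF sw \<tau>])
      then show "continuous_on {0..} Q" unfolding Q_def using N(1) N0(1) S
        by (auto intro!: continuous_intros simp: memory_system_def)
      fix r :: real assume r: "r > 0"
      obtain d where d: "(N has_real_derivative d) (at r)" "d \<le> - (A * (\<tau> * u2 r + u1 r)\<^sup>2)"
        using N(2)[OF r] by blast
      obtain d0 where d0: "(N0 has_real_derivative d0) (at r)" "d0 \<le> - (A * (\<tau> * U2 r + U1 r)\<^sup>2)"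
        using N0(2)[OF r] by blast
      define v1 where "v1 = \<tau> * w2 r + w1 r"
      define vu where "vu = \<tau> * u2 r + u1 r"
      define vU where "vU = \<tau> * U2 r + U1 r"
      define e where "e = - 2 * m * A * (w r - y r / \<tau>)\<^sup>2 - \<delta> * A * (w1 r)\<^sup>2 - \<delta> * A * U1 r * v1"
      have E': "(E has_real_derivative e) (at r)"
        using DERIV_energy[OF sw \<tau> r] unfolding E_def e_def v1_def .
      have U1': "(U1 has_real_derivative U2 r) (at r)" using S r by (simp add: memory_system_def)
      have "(Q has_real_derivative e + \<delta> / 2 * (\<tau> * A * (2 * U1 r * U2 r) + 3 * d0 + 2 * d)) (at r)"
        unfolding Q_def by (auto intro!: derivative_eq_intros E' U1' d(1) d0(1))
      moreover have "e + \<delta> / 2 * (\<tau> * A * (2 * U1 r * U2 r) + 3 * d0 + 2 * d) \<le> 0"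
      proof -
        have "v1 = vu - vU" by (simp add: v1_def vu_def vU_def w1_def w2_def algebra_simps)
        then have v1: "v1\<^sup>2 \<le> 2 * vu\<^sup>2 + 2 * vU\<^sup>2"
          using zero_le_power2[of "vu + vU"] by (simp add: power2_diff power2_sum)
        have "- (2 * U1 r * v1) \<le> (U1 r)\<^sup>2 + v1\<^sup>2"
          using zero_le_power2[of "U1 r + v1"] by (simp add: power2_sum)
        moreover have "\<tau> * (2 * U1 r * U2 r) = 2 * U1 r * vU - 2 * (U1 r)\<^sup>2"
          by (simp add: vU_def algebra_simps power2_eq_square)
        moreover have "2 * U1 r * vU \<le> (U1 r)\<^sup>2 + vU\<^sup>2"
          using zero_le_power2[of "U1 r - vU"] by (simp add: power2_diff)
        \<comment> \<open>The weights in \<open>Q\<close> come from here: \<open>v1\<^sup>2\<close>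
          costs \<open>2 vu\<^sup>2 + 2 vU\<^sup>2\<close>, and the derivative of
          \<open>\<tau> U1\<^sup>2\<close> costs one more \<open>vU\<^sup>2\<close>, while its
          \<open>- U1\<^sup>2\<close> absorbs the Young term.\<close>
        ultimately have "- (2 * U1 r * v1) + \<tau> * (2 * U1 r * U2 r) - 3 * vU\<^sup>2 - 2 * vu\<^sup>2 \<le> 0"
          using v1 by linarith
        then have 1: "A * (- (2 * U1 r * v1) + \<tau> * (2 * U1 r * U2 r) - 3 * vU\<^sup>2 - 2 * vu\<^sup>2) \<le> 0"
          using A by (rule mult_nonneg_nonpos[rotated])
        have "- (2 * A * U1 r * v1) + \<tau> * A * (2 * U1 r * U2 r) + 3 * d0 + 2 * d \<le> 0"
          using 1 d(2) d0(2) unfolding vu_def[symmetric] vU_def[symmetric] by (simp add: algebra_simps)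
        then have 2: "\<delta> / 2 * (- (2 * A * U1 r * v1) + \<tau> * A * (2 * U1 r * U2 r) + 3 * d0 + 2 * d) \<le> 0"
          using \<delta> by (intro mult_nonneg_nonpos) auto
        have "0 \<le> m * A * (w r - y r / \<tau>)\<^sup>2" "0 \<le> \<delta> * A * (w1 r)\<^sup>2" using A m \<delta> by auto
        then have "e \<le> - (\<delta> * A * U1 r * v1)" unfolding e_def by linarith
        then show ?thesis using 2 by (simp add: algebra_simps)
      qed
      ultimately show "\<exists>d. (Q has_real_derivative d) (at r) \<and> d \<le> 0" by blast
    qed
    have D0: "D \<ge> 0" using A by (simp add: D_def)
    have ED: "2 * E t \<le> 2 * \<delta> * (5 * K + \<tau>) * D" if t: "t \<ge> 0" for t
    proof -
      have AU: "A * (U1 0)\<^sup>2 \<le> D"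
      proof -
        have "A * (U1 0)\<^sup>2 \<le> (1 + A) * ((U 0)\<^sup>2 + (U1 0)\<^sup>2)" using A by (intro mult_mono) auto
        also have "\<dots> \<le> 1 * ((1 + A) * ((U 0)\<^sup>2 + (U1 0)\<^sup>2) + (U2 0)\<^sup>2)" by simp
        also have "\<dots> \<le> D" unfolding D_def using A by (intro mult_right_mono) auto
        finally show ?thesis .
      qed
      have "E 0 = 0" by (simp add: E_def w0 energy_def)
      then have "E t \<le> \<delta> / 2 * (\<tau> * (A * (U1 0)\<^sup>2) - \<tau> * (A * (U1 t)\<^sup>2) + 3 * (N0 0 - N0 t) + 2 * (N 0 - N t))"
        using mono[OF t] unfolding Q_def by (simp add: algebra_simps)
      also have "\<dots> \<le> \<delta> / 2 * (\<tau> * D - 0 + 3 * (K * D + K * D) + 2 * (K * D + K * D))"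
      proof -
        have "N 0 - N t \<le> K * D + K * D" "N0 0 - N0 t \<le> K * D + K * D"
          using N(3)[of 0] N(3)[OF t] N0(3)[of 0] N0(3)[OF t] by linarith+
        then show ?thesis using \<delta> AU \<tau> A
          by (intro mult_left_mono add_mono diff_mono) auto
      qed
      also have "\<dots> \<le> \<delta> * (5 * K + \<tau>) * D"
        using \<delta> \<tau> D0 by (simp add: algebra_simps)
      finally show ?thesis by simp
    qed
    define X where "X = 2 * \<delta> * (5 * K + \<tau>) * D"
    have v1: "(\<tau> * w2 t + w1 t)\<^sup>2 \<le> X" if "t \<ge> 0" for t
      using energy_v1[OF \<tau> m mt A \<delta>(1)] ED[OF that] unfolding E_def X_def by (rule order_trans)
    have v: "A * (\<tau> * w1 t + w t)\<^sup>2 \<le> X / (1 - m * \<tau>)" if "t \<ge> 0" for t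
      using order_trans[OF energy_v[OF \<tau> m mt A \<delta>(1)] ED[OF that, unfolded E_def]] mt
      unfolding X_def by (simp add: pos_le_divide_eq mult.commute)
    have w1: "(w1 t)\<^sup>2 \<le> X"
      using memory_system_u1_bound[OF sw \<tau> t, of X] v1 w0 by simp
    \<comment> \<open>The relaxation bound needs an estimate of
      \<open>(\<tau> * w1 + w)\<^sup>2\<close> without the factor \<open>A\<close>, hence the
      division. For \<open>A = 0\<close> only nonnegativity of the right-hand side is
      claimed.\<close>
    have w: "A * (w t)\<^sup>2 \<le> X / (1 - m * \<tau>)"
    proof (cases "A = 0")
      case True
      then show ?thesis using v[OF t] by simp
    next
      case False
      then have "A > 0" using A by simp
      have "(w t)\<^sup>2 \<le> X / (1 - m * \<tau>) / A + (w 0)\<^sup>2"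
        by (rule memory_system_u_bound[OF sw \<tau> t], subst pos_le_divide_eq[OF \<open>A > 0\<close>])
           (use v in \<open>simp add: mult.commute\<close>)
      then have "w t ^ 2 * A \<le> X / (1 - m * \<tau>)"
        using w0 unfolding pos_le_divide_eq[OF \<open>A > 0\<close>, symmetric] by simp
      then show ?thesis by (simp only: mult.commute)
    qed
    have "(\<tau> * w2 t + w1 t)\<^sup>2 + A * (\<tau> * w1 t + w t)\<^sup>2 + (w1 t)\<^sup>2 + A * (w t)\<^sup>2 \<le> c * X"
    proof -
      have "c * X = 2 * X + 2 * (X / (1 - m * \<tau>))" by (simp add: c_def distrib_right)
      then show ?thesis using v1[OF t] v[OF t] w1 w by linarith
    qed
    also have "\<dots> = C * \<delta> * D" by (simp add: C_def X_def)
    finally show "(\<tau> * (u2 t - U2 t) + (u1 t - U1 t))\<^sup>2 + A * (\<tau> * (u1 t - U1 t) + (u t - U t))\<^sup>2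
        + (u1 t - U1 t)\<^sup>2 + A * (u t - U t)\<^sup>2
      \<le> C * \<delta> * (1 + A)\<^sup>2 * ((1 + A) * ((U 0)\<^sup>2 + (U1 0)\<^sup>2) + (U2 0)\<^sup>2)"
      unfolding w_def w1_def w2_def D_def by (simp add: mult.assoc)
  qed
qed

section \<open>Complex modes\<close>

text \<open>The equation has real coefficients, so the real estimates apply to the real and imaginary parts;
  both are covered by a bounded linear functional \<open>L\<close>.\<close>

lemma mode_solution_memory_system:
  fixes y :: "real \<Rightarrow> complex"
  assumes "mode_solution \<tau> m \<delta> \<rho> a b c y" and \<tau>: "\<tau> > 0"
  obtains y1 y2 where
    "\<And>t. t \<ge> 0 \<Longrightarrow> (y has_vector_derivative y1 t) (at t within {0..})"
    "\<And>t. t \<ge> 0 \<Longrightarrow> (y1 has_vector_derivative y2 t) (at t within {0..})"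
    "y 0 = a" "y1 0 = b" "y2 0 = c"
    "\<And>L. bounded_linear L \<Longrightarrow> \<exists>z. memory_system \<tau> m \<delta> (\<rho>\<^sup>2) (\<lambda>t. 0) (\<lambda>t. L (y t)) (\<lambda>t. L (y1 t)) (\<lambda>t. L (y2 t)) z"
proof -
  obtain y1 y2 y3 where d: "\<And>t. t \<ge> 0 \<Longrightarrow> (y has_vector_derivative y1 t) (at t within {0..})"
        "\<And>t. t \<ge> 0 \<Longrightarrow> (y1 has_vector_derivative y2 t) (at t within {0..})"
        "\<And>t. t \<ge> 0 \<Longrightarrow> (y2 has_vector_derivative y3 t) (at t within {0..})"
    and init: "y 0 = a" "y1 0 = b" "y2 0 = c"
    and eq: "\<And>t. t > 0 \<Longrightarrow> \<tau> *\<^sub>R y3 t + y2 t - (- \<rho>\<^sup>2) *\<^sub>R y t - ((\<delta> + \<tau>) * (- \<rho>\<^sup>2)) *\<^sub>R y1 t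
               + integral {0..t} (\<lambda>\<eta>. (m * exp (- (t - \<eta>) / \<tau>) * (- \<rho>\<^sup>2)) *\<^sub>R y \<eta>) = 0"
    using assms(1) unfolding mode_solution_def by blast
  have cont: "continuous_on {0..} y" "continuous_on {0..} y1" "continuous_on {0..} y2"
    using d by (auto simp: continuous_on_eq_continuous_within intro: has_vector_derivative_continuous)
  have "\<exists>z. memory_system \<tau> m \<delta> (\<rho>\<^sup>2) (\<lambda>t. 0) (\<lambda>t. L (y t)) (\<lambda>t. L (y1 t)) (\<lambda>t. L (y2 t)) z"
    if L: "bounded_linear L" for L
  proof -
    \<comment> \<open>The factor \<open>exp (- t / \<tau>)\<close> is taken out of the memory
      integral, so that \<open>t\<close> remains only in the upper limit and the fundamental theorem
      of calculus applies. The product rule then gives the equation for \<open>z\<close>.\<close>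
    define I where "I t = integral {0..t} (\<lambda>\<eta>. exp (\<eta> / \<tau>) * L (y \<eta>))" for t
    define z where "z t = exp (- t / \<tau>) * I t" for t
    have cL: "continuous_on {0..} (\<lambda>t. L (y t))" "continuous_on {0..} (\<lambda>t. L (y1 t))" "continuous_on {0..} (\<lambda>t. L (y2 t))"
      using cont by (auto intro: bounded_linear.continuous_on[OF L])
    have c0: "continuous_on {0..T} (\<lambda>\<eta>. exp (\<eta> / \<tau>) * L (y \<eta>))" for T
      by (intro continuous_intros continuous_on_subset[OF cL(1)]) (use \<tau> in auto)
    have dI: "(I has_real_derivative exp (t / \<tau>) * L (y t)) (at t within {0..T})" if "t \<in> {0..T}" for t T
      unfolding I_def using integral_has_real_derivative[OF c0 that] .
    have dI': "(I has_real_derivative exp (t / \<tau>) * L (y t)) (at t)" if "t > 0" for t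
      using dI[of t "t + 1"] that by (simp add: at_within_Icc_at)
    have cI: "continuous_on {0..} I"
      unfolding continuous_on_eq_continuous_within
    proof
      fix t :: real assume t: "t \<in> {0..}"
      \<comment> \<open>The derivative of \<open>I\<close> is known on compact intervals; near
        \<open>t\<close> such an interval agrees with the half line, including at the left
        endpoint.\<close>
      have "at t within {0..t + 1} = at t within {0..}"
        by (rule at_within_nhd[of _ "{..<t + 1}"]) auto
      then show "continuous (at t within {0..}) I"
        using DERIV_continuous[OF dI[of t "t + 1"]] t by simp
    qed
    have "memory_system \<tau> m \<delta> (\<rho>\<^sup>2) (\<lambda>t. 0) (\<lambda>t. L (y t)) (\<lambda>t. L (y1 t)) (\<lambda>t. L (y2 t)) z"
      unfolding memory_system_def
    proof (intro conjI allI impI cL)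
      show "continuous_on {0..} z" unfolding z_def using \<tau> by (intro continuous_intros cI) auto
      show "z 0 = 0" by (simp add: z_def I_def)
      fix t :: real assume t: "t > 0"
      have at: "at t within {0..} = at t" using t by (intro at_within_interior) auto
      have dL: "((\<lambda>t. L (f t)) has_real_derivative L f') (at t)"
        if "(f has_vector_derivative f') (at t within {0..})" for f f'
        using bounded_linear.has_vector_derivative[OF L that]
        unfolding at has_real_derivative_iff_has_vector_derivative .
      show "((\<lambda>t. L (y t)) has_real_derivative L (y1 t)) (at t)"
           "((\<lambda>t. L (y1 t)) has_real_derivative L (y2 t)) (at t)"
        using d t by (auto intro!: dL)
      show "(z has_real_derivative L (y t) - z t / \<tau>) (at t)"
        unfolding z_def using \<tau>
        by (auto intro!: derivative_eq_intros dI'[OF t] simp: exp_minus field_simps)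
      have "(\<lambda>\<eta>. (m * exp (- (t - \<eta>) / \<tau>) * (- \<rho>\<^sup>2)) *\<^sub>R y \<eta>) integrable_on {0..t}"
        by (intro integrable_continuous_real continuous_intros continuous_on_subset[OF cont(1)]) (use \<tau> in auto)
      then have "L (integral {0..t} (\<lambda>\<eta>. (m * exp (- (t - \<eta>) / \<tau>) * (- \<rho>\<^sup>2)) *\<^sub>R y \<eta>))
          = integral {0..t} (\<lambda>\<eta>. L ((m * exp (- (t - \<eta>) / \<tau>) * (- \<rho>\<^sup>2)) *\<^sub>R y \<eta>))"
        using integral_linear[OF _ L] by (metis (no_types, lifting) Henstock_Kurzweil_Integration.integral_cong o_apply)
      also have "\<dots> = integral {0..t} (\<lambda>\<eta>. (- m * \<rho>\<^sup>2 * exp (- t / \<tau>)) * (exp (\<eta> / \<tau>) * L (y \<eta>)))"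
        by (intro Henstock_Kurzweil_Integration.integral_cong)
           (simp only: linear_cmul[OF bounded_linear.linear[OF L]],
            simp add: diff_divide_distrib exp_diff exp_minus field_simps)
      also have "\<dots> = - m * \<rho>\<^sup>2 * z t"
        unfolding Henstock_Kurzweil_Integration.integral_mult_right by (simp add: z_def I_def)
      finally have LI: "L (integral {0..t} (\<lambda>\<eta>. (m * exp (- (t - \<eta>) / \<tau>) * (- \<rho>\<^sup>2)) *\<^sub>R y \<eta>)) = - m * \<rho>\<^sup>2 * z t" .
      note lin = linear_add[OF bounded_linear.linear[OF L]] linear_diff[OF bounded_linear.linear[OF L]]
          linear_cmul[OF bounded_linear.linear[OF L]] linear_0[OF bounded_linear.linear[OF L]]
      have "\<tau> * L (y3 t) + L (y2 t) + \<rho>\<^sup>2 * L (y t) + (\<delta> + \<tau>) * \<rho>\<^sup>2 * L (y1 t) - m * \<rho>\<^sup>2 * z t = 0"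
        using arg_cong[OF eq[OF t], of L] unfolding lin LI real_scaleR_def by (simp add: algebra_simps)
      then have "L (y3 t) = - (L (y2 t) + \<rho>\<^sup>2 * L (y t) + (\<delta> + \<tau>) * \<rho>\<^sup>2 * L (y1 t) - m * \<rho>\<^sup>2 * z t + 0) / \<tau>"
        using \<tau> by (simp add: field_simps)
      then show "((\<lambda>t. L (y2 t)) has_real_derivative
          - (L (y2 t) + \<rho>\<^sup>2 * L (y t) + (\<delta> + \<tau>) * \<rho>\<^sup>2 * L (y1 t) - m * \<rho>\<^sup>2 * z t + 0) / \<tau>) (at t)"
        using dL[OF d(3)] t by simp
    qed
    then show ?thesis by blast
  qed
  then show thesis using that d init by blast
qed

text \<open>The four bounded quantities are the frequency-side ingredients of the norm
  \<open>E_inf_norm\<close>. The value \<open>w\<close> is bounded only with the factor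
  \<open>\<rho>\<close>; at low frequencies it is recovered on bounded time intervals from
  \<open>w 0 = 0\<close> and the bound on \<open>w1\<close>.\<close>

definition controlled_mode ::
    "real \<Rightarrow> (real \<Rightarrow> complex) \<Rightarrow> (real \<Rightarrow> complex) \<Rightarrow> (real \<Rightarrow> complex) \<Rightarrow> real \<Rightarrow> bool" where
  "controlled_mode \<rho> w w1 w2 B \<longleftrightarrow> w 0 = 0 \<and>
     (\<forall>t\<ge>0. (w has_vector_derivative w1 t) (at t within {0..}) \<and>
       (w1 has_vector_derivative w2 t) (at t within {0..}) \<and>
       norm (w1 t) \<le> B \<and> norm (w2 t) \<le> B \<and> \<rho> * norm (w t) \<le> B \<and> \<rho> * norm (w1 t) \<le> B)"

lemma controlled_mode_mono:
  "controlled_mode \<rho> w w1 w2 B \<Longrightarrow> B \<le> B' \<Longrightarrow> controlled_mode \<rho> w w1 w2 B'"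
  unfolding controlled_mode_def by (meson order_trans)

text \<open>The real estimate for squares is applied to real and imaginary parts and added; taking
  roots produces \<open>sqrt \<delta>\<close>. The triangle inequality then extracts
  \<open>w2\<close> from \<open>\<tau> w2 + w1\<close> and \<open>w1\<close> from
  \<open>\<tau> w1 + w\<close>.\<close>

lemma mode_difference_bound:
  fixes \<tau> m :: real
  assumes \<tau>: "\<tau> > 0" and m: "m > 0" and mt: "m * \<tau> < 1"
  obtains K where "K > 0"
    "\<And>\<delta> \<rho> a b c y Y. \<rho> \<ge> 0 \<Longrightarrow> 0 \<le> \<delta> \<Longrightarrow> \<delta> \<le> 1 \<Longrightarrow>
      mode_solution \<tau> m \<delta> \<rho> a b c y \<Longrightarrow> mode_solution \<tau> m 0 \<rho> a b c Y \<Longrightarrow>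
      \<exists>w1 w2. controlled_mode \<rho> (\<lambda>t. y t - Y t) w1 w2
        (K * sqrt \<delta> * ((1 + \<rho>\<^sup>2) * sqrt ((1 + \<rho>\<^sup>2) * ((norm a)\<^sup>2 + (norm b)\<^sup>2) + (norm c)\<^sup>2)))"
proof -
  obtain K where K: "K > 0"
    "\<And>A \<delta> u u1 u2 z U U1 U2 Z t. A \<ge> 0 \<Longrightarrow> 0 \<le> \<delta> \<Longrightarrow> \<delta> \<le> 1 \<Longrightarrow>
      memory_system \<tau> m \<delta> A (\<lambda>t. 0) u u1 u2 z \<Longrightarrow> memory_system \<tau> m 0 A (\<lambda>t. 0) U U1 U2 Z \<Longrightarrow>
      u 0 = U 0 \<Longrightarrow> u1 0 = U1 0 \<Longrightarrow> u2 0 = U2 0 \<Longrightarrow> t \<ge> 0 \<Longrightarrow>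
      (\<tau> * (u2 t - U2 t) + (u1 t - U1 t))\<^sup>2 + A * (\<tau> * (u1 t - U1 t) + (u t - U t))\<^sup>2
        + (u1 t - U1 t)\<^sup>2 + A * (u t - U t)\<^sup>2
      \<le> K * \<delta> * (1 + A)\<^sup>2 * ((1 + A) * ((U 0)\<^sup>2 + (U1 0)\<^sup>2) + (U2 0)\<^sup>2)"
    using memory_system_difference_bound[OF \<tau> m mt] by metis
  \<comment> \<open>Two of the quantities are bounded by \<open>B\<close> directly. The other two
    are differences of such quantities divided by \<open>\<tau>\<close>, hence
    \<open>2 / \<tau>\<close>.\<close>
  define C where "C = (1 + 2 / \<tau>) * sqrt K"
  show ?thesis
  proof (rule that[of C])
    show "C > 0" using K \<tau> by (auto simp: C_def intro!: add_pos_pos mult_pos_pos)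
    fix \<delta> \<rho> :: real and a b c y Y
    assume \<rho>: "\<rho> \<ge> 0" and \<delta>: "0 \<le> \<delta>" "\<delta> \<le> 1"
      and s: "mode_solution \<tau> m \<delta> \<rho> a b c y" and S: "mode_solution \<tau> m 0 \<rho> a b c Y"
    obtain y1 y2 where y:
      "\<And>t. t \<ge> 0 \<Longrightarrow> (y has_vector_derivative y1 t) (at t within {0..})"
      "\<And>t. t \<ge> 0 \<Longrightarrow> (y1 has_vector_derivative y2 t) (at t within {0..})"
      "y 0 = a" "y1 0 = b" "y2 0 = c"
      "\<And>L. bounded_linear L \<Longrightarrow> \<exists>z. memory_system \<tau> m \<delta> (\<rho>\<^sup>2) (\<lambda>t. 0) (\<lambda>t. L (y t)) (\<lambda>t. L (y1 t)) (\<lambda>t. L (y2 t)) z"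
      by (rule mode_solution_memory_system[OF s \<tau>]) blast
    obtain Y1 Y2 where Y:
      "\<And>t. t \<ge> 0 \<Longrightarrow> (Y has_vector_derivative Y1 t) (at t within {0..})"
      "\<And>t. t \<ge> 0 \<Longrightarrow> (Y1 has_vector_derivative Y2 t) (at t within {0..})"
      "Y 0 = a" "Y1 0 = b" "Y2 0 = c"
      "\<And>L. bounded_linear L \<Longrightarrow> \<exists>z. memory_system \<tau> m 0 (\<rho>\<^sup>2) (\<lambda>t. 0) (\<lambda>t. L (Y t)) (\<lambda>t. L (Y1 t)) (\<lambda>t. L (Y2 t)) z"
      by (rule mode_solution_memory_system[OF S \<tau>]) blast
    define w w1 w2 where "w t = y t - Y t" and "w1 t = y1 t - Y1 t" and "w2 t = y2 t - Y2 t" for t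
    define D where "D = (1 + \<rho>\<^sup>2) * ((norm a)\<^sup>2 + (norm b)\<^sup>2) + (norm c)\<^sup>2"
    define B where "B = sqrt K * sqrt \<delta> * ((1 + \<rho>\<^sup>2) * sqrt D)"
    have D0: "D \<ge> 0" by (simp add: D_def)
    have B0: "B \<ge> 0" using K \<delta> D0 by (simp add: B_def)
    have B2: "B\<^sup>2 = K * \<delta> * (1 + \<rho>\<^sup>2)\<^sup>2 * D"
      using K(1) \<delta> D0 by (simp add: B_def power_mult_distrib)
    have bd: "x \<le> C * sqrt \<delta> * ((1 + \<rho>\<^sup>2) * sqrt D)"
      if t: "t \<ge> 0" and x: "x \<in> {norm (w1 t), norm (w2 t), \<rho> * norm (w t), \<rho> * norm (w1 t)}" for t x
    proof -
      define v v1 where "v = \<tau> *\<^sub>R w1 t + w t" and "v1 = \<tau> *\<^sub>R w2 t + w1 t"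
      have L: "(L v1)\<^sup>2 + \<rho>\<^sup>2 * (L v)\<^sup>2 + (L (w1 t))\<^sup>2 + \<rho>\<^sup>2 * (L (w t))\<^sup>2
           \<le> K * \<delta> * (1 + \<rho>\<^sup>2)\<^sup>2 * ((1 + \<rho>\<^sup>2) * ((L a)\<^sup>2 + (L b)\<^sup>2) + (L c)\<^sup>2)" if L: "bounded_linear L" for L
      proof -
        obtain z Z where "memory_system \<tau> m \<delta> (\<rho>\<^sup>2) (\<lambda>t. 0) (\<lambda>t. L (y t)) (\<lambda>t. L (y1 t)) (\<lambda>t. L (y2 t)) z"
             "memory_system \<tau> m 0 (\<rho>\<^sup>2) (\<lambda>t. 0) (\<lambda>t. L (Y t)) (\<lambda>t. L (Y1 t)) (\<lambda>t. L (Y2 t)) Z"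
          using y(6)[OF L] Y(6)[OF L] by blast
        from K(2)[OF _ \<delta> this _ _ _ t] y(3-5) Y(3-5) show ?thesis
          using linear_add[OF bounded_linear.linear[OF L]] linear_diff[OF bounded_linear.linear[OF L]]
          linear_cmul[OF bounded_linear.linear[OF L]]
          by (simp add: v_def v1_def w_def w1_def w2_def)
      qed
      have sum: "(norm v1)\<^sup>2 + \<rho>\<^sup>2 * (norm v)\<^sup>2 + (norm (w1 t))\<^sup>2 + \<rho>\<^sup>2 * (norm (w t))\<^sup>2 \<le> B\<^sup>2"
        using add_mono[OF L[OF bounded_linear_Re] L[OF bounded_linear_Im]]
        unfolding B2 D_def cmod_power2 by (simp add: algebra_simps)
      have n: "0 \<le> (norm v1)\<^sup>2" "0 \<le> \<rho>\<^sup>2 * (norm v)\<^sup>2" "0 \<le> (norm (w1 t))\<^sup>2" "0 \<le> \<rho>\<^sup>2 * (norm (w t))\<^sup>2"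
        by auto
      have "(norm v1)\<^sup>2 \<le> B\<^sup>2" "\<rho>\<^sup>2 * (norm v)\<^sup>2 \<le> B\<^sup>2" "(norm (w1 t))\<^sup>2 \<le> B\<^sup>2" "\<rho>\<^sup>2 * (norm (w t))\<^sup>2 \<le> B\<^sup>2"
        using sum n by linarith+
      then have e: "norm v1 \<le> B" "\<rho> * norm v \<le> B" "norm (w1 t) \<le> B" "\<rho> * norm (w t) \<le> B"
        by (auto intro!: power2_le_imp_le[OF _ B0] simp: power_mult_distrib)
      have "\<tau> * norm (w2 t) = norm (v1 - w1 t)" using \<tau> by (simp add: v1_def)
      also have "\<dots> \<le> 2 * B" using norm_triangle_ineq4[of v1 "w1 t"] e by linarith
      finally have w2: "norm (w2 t) \<le> 2 / \<tau> * B" using \<tau> by (simp add: field_simps)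
      have "\<tau> * (\<rho> * norm (w1 t)) = \<rho> * norm (v - w t)" using \<tau> by (simp add: v_def)
      also have "\<dots> \<le> \<rho> * norm v + \<rho> * norm (w t)"
        using norm_triangle_ineq4[of v "w t"] \<rho> by (metis distrib_left mult_left_mono)
      also have "\<dots> \<le> 2 * B" using e by linarith
      finally have "\<rho> * norm (w1 t) \<le> 2 / \<tau> * B" using \<tau> by (simp add: field_simps)
      moreover have "0 \<le> 2 / \<tau> * B" using \<tau> B0 by simp
      moreover have "(1 + 2 / \<tau>) * B = B + 2 / \<tau> * B" by (simp add: algebra_simps)
      ultimately have "x \<le> (1 + 2 / \<tau>) * B" using e x B0 w2 by auto
      then show ?thesis unfolding B_def C_def by (simp only: mult.assoc)
    qed
    have "controlled_mode \<rho> (\<lambda>t. y t - Y t) w1 w2 (C * sqrt \<delta> * ((1 + \<rho>\<^sup>2) * sqrt D))"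
      unfolding controlled_mode_def
    proof (intro conjI allI impI)
      show "y 0 - Y 0 = 0" using y Y by simp
      fix t :: real assume t: "t \<ge> 0"
      show "((\<lambda>t. y t - Y t) has_vector_derivative w1 t) (at t within {0..})"
        unfolding w1_def using y(1) Y(1) t by (auto intro!: derivative_intros)
      show "(w1 has_vector_derivative w2 t) (at t within {0..})"
        unfolding w1_def w2_def using y(2) Y(2) t by (auto intro!: derivative_intros)
    qed (use bd in \<open>simp_all add: w_def\<close>)
    then show "\<exists>w1 w2. controlled_mode \<rho> (\<lambda>t. y t - Y t) w1 w2
        (C * sqrt \<delta> * ((1 + \<rho>\<^sup>2) * sqrt ((1 + \<rho>\<^sup>2) * ((norm a)\<^sup>2 + (norm b)\<^sup>2) + (norm c)\<^sup>2)))"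
      unfolding D_def by blast
  qed
qed

section \<open>Inverse Fourier transforms of controlled modes\<close>

text \<open>Dyadic balls: the function is dominated by a series of multiples of indicators of the
  balls of radius \<open>2 ^ k\<close>. The integrals of the summands form a geometric series with
  ratio \<open>2 powr (n - p)\<close> in dimension \<open>n\<close>, which converges for
  \<open>p > n\<close>.\<close>

lemma integrable_japanese_bracket:
  fixes p :: real
  assumes p: "p > real CARD('n)"
  shows "integrable lborel (\<lambda>\<xi>::real^'n. (1 + (norm \<xi>)\<^sup>2) powr (- p / 2))"
proof -
  let ?n = "real CARD('n)"
  let ?f = "\<lambda>\<xi>::real^'n. (1 + (norm \<xi>)\<^sup>2) powr (- p / 2)"
  \<comment> \<open>This is \<open>(r\<^sup>2) powr (- p / 2)\<close> at the inner radius
    \<open>r = 2 powr (k - 1)\<close>.\<close>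
  define a where "a k = 2 powr (p * (1 - real k))" for k :: nat
  have p0: "p > 0" using p by linarith
  have dom: "ennreal (?f \<xi>) \<le> (\<Sum>k. ennreal (a k) * indicator (cball 0 (2 ^ k)) \<xi>)" for \<xi> :: "real^'n"
  proof -
    obtain j where "norm \<xi> < 2 ^ j" using real_arch_pow[of 2 "norm \<xi>"] by auto
    then have ex: "norm \<xi> \<le> 2 ^ j" by simp
    define k where "k = (LEAST k. norm \<xi> \<le> 2 ^ k)"
    have k: "norm \<xi> \<le> 2 ^ k" unfolding k_def using ex by (rule LeastI)
    have "(2 powr (real k - 1))\<^sup>2 \<le> 1 + (norm \<xi>)\<^sup>2"
    \<comment> \<open>For \<open>k = 0\<close> there is no lower bound on the norm, and the summand
      1 of the bracket suffices. Otherwise minimality of \<open>k\<close> gives the bound.\<close>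
    proof (cases k)
      case 0
      then show ?thesis by (simp add: powr_minus power_divide)
    next
      case (Suc i)
      then have "\<not> norm \<xi> \<le> 2 ^ i" using not_less_Least[of i "\<lambda>k. norm \<xi> \<le> 2 ^ k"] unfolding k_def by auto
      then have "2 powr (real k - 1) \<le> norm \<xi>" using Suc by (simp add: powr_realpow)
      then have "(2 powr (real k - 1))\<^sup>2 \<le> (norm \<xi>)\<^sup>2" by (intro power_mono) auto
      then show ?thesis by linarith
    qed
    then have "?f \<xi> \<le> ((2 powr (real k - 1))\<^sup>2) powr (- p / 2)"
      using p0 by (intro powr_mono2') auto
    also have "\<dots> = a k"
      unfolding a_def power2_eq_square powr_add[symmetric] powr_powr
      by (rule arg_cong[where f = "\<lambda>x. 2 powr x"]) (simp add: algebra_simps)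
    finally have "ennreal (?f \<xi>) \<le> ennreal (a k) * indicator (cball 0 (2 ^ k)) \<xi>"
      using k by (simp add: ennreal_leI)
    also have "\<dots> \<le> (\<Sum>k. ennreal (a k) * indicator (cball 0 (2 ^ k)) \<xi>)"
    proof -
      have "f k \<le> suminf f" for f :: "nat \<Rightarrow> ennreal"
        using sum_le_suminf[of f "{k}"] by simp
      then show ?thesis .
    qed
    finally show ?thesis .
  qed
  define V where "V = unit_ball_vol ?n"
  have V0: "V \<ge> 0" by (simp add: V_def)
  have "(\<integral>\<^sup>+\<xi>. ennreal (?f \<xi>) \<partial>lborel) \<le> (\<integral>\<^sup>+\<xi>. (\<Sum>k. ennreal (a k) * indicator (cball 0 (2 ^ k)) (\<xi>::real^'n)) \<partial>lborel)"
    by (intro nn_integral_mono dom)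
  also have "\<dots> = (\<Sum>k. \<integral>\<^sup>+\<xi>. ennreal (a k) * indicator (cball 0 (2 ^ k)) (\<xi>::real^'n) \<partial>lborel)"
    by (intro nn_integral_suminf borel_measurable_times_ennreal borel_measurable_indicator) auto
  also have "\<dots> = (\<Sum>k. ennreal (a k) * emeasure lborel (cball (0::real^'n) (2 ^ k)))"
    by (intro suminf_cong nn_integral_cmult_indicator) auto
  also have "\<dots> = (\<Sum>k. ennreal (V * 2 powr p * (2 powr (?n - p)) ^ k))"
  proof (intro suminf_cong)
    fix k
    have "a k * (V * (2 ^ k) ^ CARD('n)) = V * 2 powr p * (2 powr (?n - p)) ^ k"
    proof -
      have "a k = 2 powr p * 2 powr (- p * real k)"
        unfolding a_def powr_add[symmetric] by (simp add: algebra_simps)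
      moreover have "(2 powr (?n - p)) ^ k = 2 powr (?n * real k) * 2 powr (- p * real k)"
      proof -
        have "(2 powr (?n - p)) ^ k = 2 powr ((?n - p) * real k)"
          unfolding powr_powr[symmetric] by (rule powr_realpow[symmetric]) simp
        also have "(?n - p) * real k = ?n * real k + - p * real k" by (simp add: algebra_simps)
        finally show ?thesis unfolding powr_add .
      qed
      moreover have "((2::real) ^ k) ^ CARD('n) = 2 powr (?n * real k)"
        unfolding power_mult[symmetric] of_nat_mult[symmetric]
        by (subst powr_realpow) (auto simp only: mult.commute)
      ultimately show ?thesis by simp
    qed
    then show "ennreal (a k) * emeasure lborel (cball (0::real^'n) (2 ^ k)) = ennreal (V * 2 powr p * (2 powr (?n - p)) ^ k)"
      by (simp add: emeasure_cball V_def ennreal_mult'[symmetric] a_def)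
  qed
  also have "\<dots> < top"
  proof -
    have "2 powr (?n - p) < 2 powr 0" using p by (intro powr_less_mono) auto
    then have "summable (\<lambda>k. V * 2 powr p * (2 powr (?n - p)) ^ k)"
      by (intro summable_mult summable_geometric) simp
    then have "(\<Sum>k. ennreal (V * 2 powr p * (2 powr (?n - p)) ^ k)) \<noteq> top"
      by (rule ennreal_suminf_neq_top) (intro mult_nonneg_nonneg V0 zero_le_power powr_ge_zero)
    then show ?thesis by (simp only: less_top)
  qed
  finally have fin: "(\<integral>\<^sup>+\<xi>. ennreal (?f \<xi>) \<partial>lborel) < \<infinity>" by (simp only: infinity_ennreal_def)
  show ?thesis
  proof (rule integrableI_nonneg[OF _ _ fin])
    show "?f \<in> borel_measurable lborel" by measurable
    show "AE \<xi> in lborel. 0 \<le> ?f \<xi>" by (intro AE_I2 powr_ge_zero)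
  qed
qed

section \<open>Fourier integrals in the supremum norm\<close>

lemma norm_fourier_le: "norm (fourier f \<xi>) \<le> L1_norm f"
  unfolding fourier_def L1_norm_def
  by (rule order_trans[OF integral_norm_bound]) (simp add: norm_mult)

lemma borel_measurable_cis_inner [measurable]:
  "(\<lambda>(x::real^'n, \<xi>). cis (x \<bullet> \<xi>)) \<in> borel_measurable (borel \<Otimes>\<^sub>M borel)"
  unfolding borel_prod by (intro borel_measurable_continuous_onI) (auto intro!: continuous_intros simp: split_beta)

text \<open>Measurability matters because \<open>Linf_norm\<close> is infinite on nonmeasurable
  functions.\<close>

lemma inv_fourier_measurable:
  assumes [measurable]: "F \<in> borel_measurable borel"
  shows "inv_fourier F \<in> borel_measurable lborel"
proof -
  \<comment> \<open>Writing the phase as a function of the pair exposes its joint measurability, as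
    needed for an integral depending on a parameter.\<close>
  have "inv_fourier F = (\<lambda>x. (LINT \<xi>|lborel. (\<lambda>(x, \<xi>). cis (x \<bullet> \<xi>)) (x, \<xi>) * F \<xi>) / complex_of_real ((2 * pi) ^ CARD('a)))"
    by (simp add: inv_fourier_def fun_eq_iff)
  also have "\<dots> \<in> borel_measurable lborel" by measurable
  finally show ?thesis .
qed

lemma cis_inner_measurable [measurable]: "(\<lambda>\<xi>::real^'n. cis (x \<bullet> \<xi>)) \<in> borel_measurable borel"
  by (intro borel_measurable_continuous_onI continuous_intros)

lemma integrable_cis_mult:
  fixes F :: "real^'n \<Rightarrow> complex"
  assumes "integrable lborel F"
  shows "integrable lborel (\<lambda>\<xi>. cis (x \<bullet> \<xi>) * F \<xi>)"
  by (rule Bochner_Integration.integrable_bound[OF assms]) (use assms in \<open>auto simp: norm_mult\<close>)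

lemma inv_fourier_add:
  assumes "integrable lborel F" "integrable lborel G"
  shows "inv_fourier (\<lambda>\<xi>. F \<xi> + G \<xi>) x = inv_fourier F x + inv_fourier G x"
  unfolding inv_fourier_def
  by (simp add: distrib_left add_divide_distrib Bochner_Integration.integral_add integrable_cis_mult assms)

lemma inv_fourier_diff:
  assumes "integrable lborel F" "integrable lborel G"
  shows "inv_fourier (\<lambda>\<xi>. F \<xi> - G \<xi>) x = inv_fourier F x - inv_fourier G x"
  unfolding inv_fourier_def
  by (simp add: right_diff_distrib diff_divide_distrib Bochner_Integration.integral_diff integrable_cis_mult assms)

lemma inv_fourier_mult_left:
  "inv_fourier (\<lambda>\<xi>. c * F \<xi>) x = c * inv_fourier F x"
  unfolding inv_fourier_def by (simp add: mult.left_commute[of _ c])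

lemma Linf_norm_inv_fourier_le:
  fixes F :: "real^'n \<Rightarrow> complex"
  assumes [measurable]: "F \<in> borel_measurable borel" and G: "integrable lborel G" and le: "\<And>\<xi>. norm (F \<xi>) \<le> G \<xi>"
  shows "Linf_norm (inv_fourier F) \<le> ereal (LINT \<xi>|lborel. G \<xi>)"
proof -
  have F: "integrable lborel F"
    by (rule Bochner_Integration.integrable_bound[OF G]) (auto intro!: AE_I2 order_trans[OF le])
  have "norm (inv_fourier F x) \<le> (LINT \<xi>|lborel. G \<xi>)" for x
  proof -
    have G0: "0 \<le> G \<xi>" for \<xi> using le[of \<xi>] norm_ge_zero order_trans by blast
    have "norm (LINT \<xi>|lborel. cis (x \<bullet> \<xi>) * F \<xi>) \<le> (LINT \<xi>|lborel. norm (F \<xi>))"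
      by (rule order_trans[OF integral_norm_bound]) (simp add: norm_mult)
    also have "\<dots> \<le> (LINT \<xi>|lborel. G \<xi>)"
      by (intro integral_mono le G integrable_norm F)
    finally have 1: "norm (LINT \<xi>|lborel. cis (x \<bullet> \<xi>) * F \<xi>) \<le> (LINT \<xi>|lborel. G \<xi>)" .
    \<comment> \<open>The normalising constant only decreases the norm and is dropped.\<close>
    have "1 \<le> (2 * pi) ^ CARD('n)" using pi_gt3 by (intro one_le_power) simp
    then have "norm (inv_fourier F x) \<le> norm (LINT \<xi>|lborel. cis (x \<bullet> \<xi>) * F \<xi>)"
      unfolding inv_fourier_def norm_divide norm_of_real by (simp add: divide_le_eq mult_le_cancel_left1)
    then show ?thesis using 1 by simp
  qed
  then show ?thesis
    unfolding Linf_norm_def using inv_fourier_measurable[OF assms(1)]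
    by (intro esssup_I) auto
qed

section \<open>Differentiation under the inverse Fourier integral\<close>

text \<open>Sequences of difference quotients are the form in which dominated convergence and
  measurability of pointwise limits can be applied.\<close>

lemma has_vector_derivative_iff_sequentially:
  fixes f :: "real \<Rightarrow> 'a::real_normed_vector"
  shows "(f has_vector_derivative d) (at t within S) \<longleftrightarrow>
    (\<forall>X. (\<forall>i. X i \<in> S - {t}) \<longrightarrow> X \<longlonglongrightarrow> t \<longrightarrow> (\<lambda>i. (f (X i) - f t) /\<^sub>R (X i - t)) \<longlonglongrightarrow> d)"
proof -
  have "(f has_vector_derivative d) (at t within S) \<longleftrightarrow>
      ((\<lambda>s. norm ((f s - f t) - (s - t) *\<^sub>R d) / norm (s - t)) \<longlongrightarrow> 0) (at t within S)"
    unfolding has_vector_derivative_def has_derivative_iff_norm by (simp add: bounded_linear_scaleR_left)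
  also have "\<dots> \<longleftrightarrow> ((\<lambda>s. norm ((f s - f t) /\<^sub>R (s - t) - d)) \<longlongrightarrow> 0) (at t within S)"
  proof (rule filterlim_cong[OF refl refl])
    have "norm ((f s - f t) - (s - t) *\<^sub>R d) / norm (s - t) = norm ((f s - f t) /\<^sub>R (s - t) - d)" if "s \<noteq> t" for s
    proof -
      have "(f s - f t) /\<^sub>R (s - t) - d = (f s - f t - (s - t) *\<^sub>R d) /\<^sub>R (s - t)"
        using that by (simp add: scaleR_diff_right)
      then show ?thesis by (simp add: divide_inverse mult.commute)
    qed
    then show "\<forall>\<^sub>F s in at t within S. norm ((f s - f t) - (s - t) *\<^sub>R d) / norm (s - t) = norm ((f s - f t) /\<^sub>R (s - t) - d)"
      by (simp add: eventually_at_filter)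
  qed
  also have "\<dots> \<longleftrightarrow> ((\<lambda>s. (f s - f t) /\<^sub>R (s - t)) \<longlongrightarrow> d) (at t within S)"
    unfolding tendsto_norm_zero_iff by (rule LIM_zero_iff)
  finally show ?thesis unfolding tendsto_at_iff_sequentially by (simp add: o_def)
qed

lemma vector_derivative_bound:
  fixes f :: "real \<Rightarrow> 'a::real_normed_vector"
  assumes "\<And>t. t \<ge> 0 \<Longrightarrow> (f has_vector_derivative f' t) (at t within {0..})"
    and "\<And>t. t \<ge> 0 \<Longrightarrow> norm (f' t) \<le> B" and "s \<ge> 0" "t \<ge> 0"
  shows "norm (f s - f t) \<le> B * \<bar>s - t\<bar>"
proof -
  have "norm (f s - f t) \<le> B * norm (s - t)"
  proof (rule differentiable_bound[of "{0..}" f "\<lambda>t h. h *\<^sub>R f' t"])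
    show "onorm (\<lambda>h. h *\<^sub>R f' r) \<le> B" if "r \<in> {0..}" for r
      using assms(2)[of r] that by (simp add: onorm_scaleR_left onorm_id)
  qed (use assms in \<open>auto simp: has_vector_derivative_def\<close>)
  then show ?thesis by simp
qed

text \<open>The time derivative is a pointwise limit of measurable difference quotients, hence
  measurable. By the mean value inequality the quotients are dominated by \<open>G\<close>, so the
  limit passes under the integral.\<close>

lemma
  fixes W W1 :: "real \<Rightarrow> real^'n \<Rightarrow> complex"
  assumes int: "\<And>t. t \<ge> 0 \<Longrightarrow> integrable lborel (W t)"
    and d: "\<And>t \<xi>. t \<ge> 0 \<Longrightarrow> ((\<lambda>t. W t \<xi>) has_vector_derivative W1 t \<xi>) (at t within {0..})"
    and le: "\<And>t \<xi>. t \<ge> 0 \<Longrightarrow> norm (W1 t \<xi>) \<le> G \<xi>" and G: "integrable lborel G"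
  shows integrable_time_derivative: "\<And>t. t \<ge> 0 \<Longrightarrow> integrable lborel (W1 t)"
    and time_derivative_inv_fourier: "time_derivative (\<lambda>t x. inv_fourier (W t) x) (\<lambda>t x. inv_fourier (W1 t) x)"
proof -
  have meas: "W t \<in> borel_measurable borel" if "t \<ge> 0" for t
    using int[OF that] by (auto dest: borel_measurable_integrable)
  have meas1: "W1 t \<in> borel_measurable borel" if t: "t \<ge> 0" for t
  proof (rule borel_measurable_LIMSEQ_metric)
    \<comment> \<open>Approaching from the right keeps the sequence in the half line also for
      \<open>t = 0\<close>.\<close>
    define X where "X i = t + inverse (real (Suc i))" for i
    have X0: "X i \<ge> 0" "X i \<in> {0..} - {t}" for i using t by (auto simp: X_def intro: add_nonneg_nonneg)
    have "X \<longlonglongrightarrow> t + 0" unfolding X_def by (intro tendsto_intros LIMSEQ_inverse_real_of_nat)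
    then have X1: "X \<longlonglongrightarrow> t" by simp
    show "(\<lambda>\<xi>. (W (X i) \<xi> - W t \<xi>) /\<^sub>R (X i - t)) \<in> borel_measurable borel" for i
      using meas[OF X0(1)[of i]] meas[OF t] by measurable
    show "(\<lambda>i. (W (X i) \<xi> - W t \<xi>) /\<^sub>R (X i - t)) \<longlonglongrightarrow> W1 t \<xi>" if "\<xi> \<in> space borel" for \<xi>
      using d[OF t, of \<xi>] X0 X1 unfolding has_vector_derivative_iff_sequentially by blast
  qed
  show int1: "integrable lborel (W1 t)" if t: "t \<ge> 0" for t
    by (rule Bochner_Integration.integrable_bound[OF G])
       (use meas1[OF t] in \<open>auto intro!: AE_I2 order_trans[OF le[OF t]]\<close>)
  show "time_derivative (\<lambda>t x. inv_fourier (W t) x) (\<lambda>t x. inv_fourier (W1 t) x)"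
    unfolding time_derivative_def has_vector_derivative_iff_sequentially
  proof (intro allI impI)
    fix t :: real and x :: "real^'n" and X :: "nat \<Rightarrow> real"
    assume t: "t \<ge> 0" and X: "\<forall>i. X i \<in> {0..} - {t}" and lim: "X \<longlonglongrightarrow> t"
    have X0: "X i \<ge> 0" "X i \<noteq> t" for i using X by auto
    define q where "q i \<xi> = (W (X i) \<xi> - W t \<xi>) /\<^sub>R (X i - t)" for i \<xi>
    have "(\<lambda>i. LINT \<xi>|lborel. cis (x \<bullet> \<xi>) * q i \<xi>) \<longlonglongrightarrow> (LINT \<xi>|lborel. cis (x \<bullet> \<xi>) * W1 t \<xi>)"
    proof (rule integral_dominated_convergence[OF _ _ G])
      show "(\<lambda>\<xi>. cis (x \<bullet> \<xi>) * W1 t \<xi>) \<in> borel_measurable lborel" using meas1[OF t] by simp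
      show "(\<lambda>\<xi>. cis (x \<bullet> \<xi>) * q i \<xi>) \<in> borel_measurable lborel" for i
        using meas[OF X0(1)[of i]] meas[OF t] unfolding q_def by simp
      show "AE \<xi> in lborel. (\<lambda>i. cis (x \<bullet> \<xi>) * q i \<xi>) \<longlonglongrightarrow> cis (x \<bullet> \<xi>) * W1 t \<xi>"
        using d[OF t] X lim unfolding has_vector_derivative_iff_sequentially q_def
        by (intro AE_I2 tendsto_mult tendsto_const) blast
      show "AE \<xi> in lborel. norm (cis (x \<bullet> \<xi>) * q i \<xi>) \<le> G \<xi>" for i
      proof (intro AE_I2)
        fix \<xi>
        have "norm (W (X i) \<xi> - W t \<xi>) \<le> G \<xi> * \<bar>X i - t\<bar>"
          by (rule vector_derivative_bound[of "\<lambda>t. W t \<xi>"]) (use d le X0 t in auto)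
        then have "norm (W (X i) \<xi> - W t \<xi>) / \<bar>X i - t\<bar> \<le> G \<xi>"
          using X0(2)[of i] by (subst pos_divide_le_eq) auto
        then show "norm (cis (x \<bullet> \<xi>) * q i \<xi>) \<le> G \<xi>"
          by (simp add: q_def norm_mult divide_inverse mult.commute)
      qed
    qed
    then have "(\<lambda>i. inv_fourier (q i) x) \<longlonglongrightarrow> inv_fourier (W1 t) x"
      unfolding inv_fourier_def by (intro tendsto_divide tendsto_const) auto
    moreover have "inv_fourier (q i) x = (inv_fourier (W (X i)) x - inv_fourier (W t) x) /\<^sub>R (X i - t)" for i
      using inv_fourier_mult_left[of "complex_of_real (inverse (X i - t))" "\<lambda>\<xi>. W (X i) \<xi> - W t \<xi>" x]
      unfolding q_def by (simp add: scaleR_conv_of_real inv_fourier_diff int X0 t)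
    ultimately show "(\<lambda>i. (inv_fourier (W (X i)) x - inv_fourier (W t) x) /\<^sub>R (X i - t)) \<longlonglongrightarrow> inv_fourier (W1 t) x"
      by simp
  qed
qed

section \<open>Frequency decay of the data\<close>

text \<open>The function \<open>g\<close> chosen in \<open>H1_norm\<close> has a Fourier transform
  bounded by its L1 norm, and the Bessel symbol supplies the decay.\<close>

lemma norm_fourier_le_H1_norm:
  assumes "\<psi> \<in> H1_space s"
  shows "norm (fourier \<psi> \<xi>) \<le> (1 + (norm \<xi>)\<^sup>2) powr (- s / 2) * H1_norm s \<psi>"
proof -
  define g where "g = (SOME g. L1_multiplier (bessel_symbol (- s)) g \<psi>)"
  have "L1_multiplier (bessel_symbol (- s)) g \<psi>"
    using someI_ex[of "\<lambda>g. L1_multiplier (bessel_symbol (- s)) g \<psi>"] assms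
    by (simp add: g_def H1_space_def)
  then have "norm (fourier \<psi> \<xi>) = (1 + (norm \<xi>)\<^sup>2) powr (- s / 2) * norm (fourier g \<xi>)"
    by (simp add: L1_multiplier_def bessel_symbol_def norm_mult)
  also have "\<dots> \<le> (1 + (norm \<xi>)\<^sup>2) powr (- s / 2) * H1_norm s \<psi>"
    unfolding H1_norm_def g_def[symmetric] by (intro mult_left_mono norm_fourier_le) auto
  finally show ?thesis .
qed

lemma L1_norm_nonneg: "L1_norm g \<ge> 0"
  by (simp add: L1_norm_def)

lemma H1_norm_nonneg: "H1_norm s \<psi> \<ge> 0"
  by (simp add: H1_norm_def L1_norm_nonneg)

lemma riesz1_norm_nonneg: "riesz1_norm s \<psi> \<ge> 0"
  by (simp add: riesz1_norm_def L1_norm_nonneg)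

text \<open>The additional derivative of the first two data cancels the inner factor
  \<open>1 + (norm \<xi>)\<^sup>2\<close>, so the root decays with order \<open>s\<close>. The outer
  factor is the loss from the mode estimate and lowers the order to \<open>s - 2\<close>.\<close>

lemma mode_data_bound:
  assumes "\<psi>0 \<in> H1_space (s + 1)" "\<psi>1 \<in> H1_space (s + 1)" "\<psi>2 \<in> H1_space s"
  shows "(1 + (norm \<xi>)\<^sup>2) * sqrt ((1 + (norm \<xi>)\<^sup>2) * ((norm (fourier \<psi>0 \<xi>))\<^sup>2 + (norm (fourier \<psi>1 \<xi>))\<^sup>2)
      + (norm (fourier \<psi>2 \<xi>))\<^sup>2)
    \<le> (H1_norm (s + 1) \<psi>0 + H1_norm (s + 1) \<psi>1 + H1_norm s \<psi>2) * (1 + (norm \<xi>)\<^sup>2) powr (- (s - 2) / 2)"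
proof -
  define J where "J = 1 + (norm \<xi>)\<^sup>2"
  have J: "J \<ge> 1" by (simp add: J_def)
  define N0 N1 N2 where "N0 = H1_norm (s + 1) \<psi>0" and "N1 = H1_norm (s + 1) \<psi>1" and "N2 = H1_norm s \<psi>2"
  have N: "0 \<le> N0" "0 \<le> N1" "0 \<le> N2" by (simp_all add: N0_def N1_def N2_def H1_norm_nonneg)
  have a: "J * (norm (fourier \<psi> \<xi>))\<^sup>2 \<le> J powr (- s) * M\<^sup>2"
    if "\<psi> \<in> H1_space (s + 1)" "M = H1_norm (s + 1) \<psi>" for \<psi> M
  proof -
    have "(norm (fourier \<psi> \<xi>))\<^sup>2 \<le> (J powr (- (s + 1) / 2) * M)\<^sup>2"
      unfolding J_def that(2) by (intro power_mono norm_fourier_le_H1_norm that) simp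
    also have "\<dots> = J powr (- (s + 1)) * M\<^sup>2"
      by (simp add: power_mult_distrib power2_eq_square flip: powr_add)
    finally have "J * (norm (fourier \<psi> \<xi>))\<^sup>2 \<le> J * (J powr (- (s + 1)) * M\<^sup>2)"
      using J by (intro mult_left_mono) auto
    also have "\<dots> = J powr (- s) * M\<^sup>2"
      using J powr_add[of J 1 "- (s + 1)"] by simp
    finally show ?thesis .
  qed
  have "(norm (fourier \<psi>2 \<xi>))\<^sup>2 \<le> (J powr (- s / 2) * N2)\<^sup>2"
    unfolding J_def N2_def by (intro power_mono norm_fourier_le_H1_norm assms) simp
  also have "\<dots> = J powr (- s) * N2\<^sup>2"
    by (simp add: power_mult_distrib power2_eq_square flip: powr_add)
  finally have c: "(norm (fourier \<psi>2 \<xi>))\<^sup>2 \<le> J powr (- s) * N2\<^sup>2" .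
  have "J * ((norm (fourier \<psi>0 \<xi>))\<^sup>2 + (norm (fourier \<psi>1 \<xi>))\<^sup>2) + (norm (fourier \<psi>2 \<xi>))\<^sup>2
      \<le> J powr (- s) * (N0\<^sup>2 + N1\<^sup>2 + N2\<^sup>2)"
    using a[OF assms(1) N0_def] a[OF assms(2) N1_def] c by (simp add: algebra_simps)
  \<comment> \<open>Passing from the sum of squares to the square of the sum gives the sum form of
    the product norm.\<close>
  also have "\<dots> \<le> J powr (- s) * (N0 + N1 + N2)\<^sup>2"
    using N by (intro mult_left_mono) (auto simp: power2_eq_square algebra_simps)
  also have "\<dots> = (J powr (- s / 2) * (N0 + N1 + N2))\<^sup>2"
    by (simp add: power_mult_distrib power2_eq_square flip: powr_add)
  finally have "sqrt (J * ((norm (fourier \<psi>0 \<xi>))\<^sup>2 + (norm (fourier \<psi>1 \<xi>))\<^sup>2) + (norm (fourier \<psi>2 \<xi>))\<^sup>2)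
      \<le> J powr (- s / 2) * (N0 + N1 + N2)"
    using N by (intro real_le_lsqrt) auto
  then have "J * sqrt (J * ((norm (fourier \<psi>0 \<xi>))\<^sup>2 + (norm (fourier \<psi>1 \<xi>))\<^sup>2) + (norm (fourier \<psi>2 \<xi>))\<^sup>2)
      \<le> J * (J powr (- s / 2) * (N0 + N1 + N2))"
    using J by (intro mult_left_mono) auto
  also have "\<dots> = (N0 + N1 + N2) * J powr (- (s - 2) / 2)"
    using J powr_add[of J 1 "- s / 2"] by (simp add: diff_divide_distrib)
  finally show ?thesis unfolding J_def N0_def N1_def N2_def .
qed

section \<open>The difference of the two solutions as a field\<close>

lemma time_derivative_cong:
  assumes "time_derivative v w" and "\<And>t x. t \<ge> 0 \<Longrightarrow> u t x = v t x"
  shows "time_derivative u w"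
  unfolding time_derivative_def
proof (intro allI impI)
  fix t :: real and x
  assume "t \<ge> 0"
  then show "((\<lambda>s. u s x) has_vector_derivative w t x) (at t within {0..})"
    using assms by (intro has_vector_derivative_transform[of t "{0..}" "\<lambda>s. u s x" "\<lambda>s. v s x"])
      (auto simp: time_derivative_def)
qed

text \<open>Integrability of \<open>G\<close> is left out on purpose: for the second estimate the
  weight of order \<open>s1 - 2\<close> may fail to be integrable, and integrability comes only
  after one further order has been gained.\<close>

definition controlled_field ::
    "(real \<Rightarrow> real^'n \<Rightarrow> complex) \<Rightarrow> (real \<Rightarrow> real^'n \<Rightarrow> complex) \<Rightarrow> (real \<Rightarrow> real^'n \<Rightarrow> complex)
      \<Rightarrow> (real \<Rightarrow> real^'n \<Rightarrow> complex) \<Rightarrow> (real^'n \<Rightarrow> real) \<Rightarrow> bool" where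
  "controlled_field u W W1 W2 G \<longleftrightarrow>
     (\<forall>t\<ge>0. integrable lborel (W t) \<and> (\<forall>x. u t x = inv_fourier (W t) x)) \<and>
     (\<forall>\<xi>. controlled_mode (norm \<xi>) (\<lambda>t. W t \<xi>) (\<lambda>t. W1 t \<xi>) (\<lambda>t. W2 t \<xi>) (G \<xi>))"

lemma controlled_fieldD:
  assumes "controlled_field u W W1 W2 G" "t \<ge> 0"
  shows "integrable lborel (W t)" "u t x = inv_fourier (W t) x" "W 0 \<xi> = 0"
    "((\<lambda>t. W t \<xi>) has_vector_derivative W1 t \<xi>) (at t within {0..})"
    "((\<lambda>t. W1 t \<xi>) has_vector_derivative W2 t \<xi>) (at t within {0..})"
    "norm (W1 t \<xi>) \<le> G \<xi>" "norm (W2 t \<xi>) \<le> G \<xi>"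
    "norm \<xi> * norm (W t \<xi>) \<le> G \<xi>" "norm \<xi> * norm (W1 t \<xi>) \<le> G \<xi>"
  using assms unfolding controlled_field_def controlled_mode_def by blast+

text \<open>The mode estimate is combined with the decay of the data at each frequency. The constant
  is fixed before \<open>s\<close>, \<open>\<delta>\<close> and the data.\<close>

lemma mgt_difference_bound:
  fixes \<tau> m :: real
  assumes \<tau>: "\<tau> > 0" and m: "m > 0" and mt: "m * \<tau> < 1"
  obtains K where "K > 0"
    "\<And>s \<delta> (\<psi>0 :: real^'n \<Rightarrow> complex) \<psi>1 \<psi>2 \<psi>\<delta> \<psi>z. 0 \<le> \<delta> \<Longrightarrow> \<delta> \<le> 1 \<Longrightarrow>
      \<psi>0 \<in> H1_space (s + 1) \<Longrightarrow> \<psi>1 \<in> H1_space (s + 1) \<Longrightarrow> \<psi>2 \<in> H1_space s \<Longrightarrow>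
      mgt_solution \<tau> m \<delta> \<psi>0 \<psi>1 \<psi>2 \<psi>\<delta> \<Longrightarrow> mgt_solution \<tau> m 0 \<psi>0 \<psi>1 \<psi>2 \<psi>z \<Longrightarrow>
      \<exists>W W1 W2. controlled_field (\<lambda>t x. \<psi>\<delta> t x - \<psi>z t x) W W1 W2
        (\<lambda>\<xi>. K * sqrt \<delta> * (H1_norm (s + 1) \<psi>0 + H1_norm (s + 1) \<psi>1 + H1_norm s \<psi>2)
          * (1 + (norm \<xi>)\<^sup>2) powr (- (s - 2) / 2))"
proof -
  obtain K where K: "K > 0"
    "\<And>\<delta> \<rho> a b c y Y. \<rho> \<ge> 0 \<Longrightarrow> 0 \<le> \<delta> \<Longrightarrow> \<delta> \<le> 1 \<Longrightarrow>
      mode_solution \<tau> m \<delta> \<rho> a b c y \<Longrightarrow> mode_solution \<tau> m 0 \<rho> a b c Y \<Longrightarrow>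
      \<exists>w1 w2. controlled_mode \<rho> (\<lambda>t. y t - Y t) w1 w2
        (K * sqrt \<delta> * ((1 + \<rho>\<^sup>2) * sqrt ((1 + \<rho>\<^sup>2) * ((norm a)\<^sup>2 + (norm b)\<^sup>2) + (norm c)\<^sup>2)))"
    by (rule mode_difference_bound[OF \<tau> m mt]) blast
  show ?thesis
  proof (rule that[OF K(1)])
    fix s \<delta> :: real and \<psi>0 \<psi>1 \<psi>2 :: "real^'n \<Rightarrow> complex" and \<psi>\<delta> \<psi>z
    assume \<delta>: "0 \<le> \<delta>" "\<delta> \<le> 1"
      and data: "\<psi>0 \<in> H1_space (s + 1)" "\<psi>1 \<in> H1_space (s + 1)" "\<psi>2 \<in> H1_space s"
      and sol: "mgt_solution \<tau> m \<delta> \<psi>0 \<psi>1 \<psi>2 \<psi>\<delta>" "mgt_solution \<tau> m 0 \<psi>0 \<psi>1 \<psi>2 \<psi>z"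
    obtain Y where Y:
      "\<And>\<xi>. mode_solution \<tau> m \<delta> (norm \<xi>) (fourier \<psi>0 \<xi>) (fourier \<psi>1 \<xi>) (fourier \<psi>2 \<xi>) (\<lambda>t. Y t \<xi>)"
      "\<And>t. t \<ge> 0 \<Longrightarrow> integrable lborel (Y t)" "\<And>t x. t \<ge> 0 \<Longrightarrow> \<psi>\<delta> t x = inv_fourier (Y t) x"
      using sol(1) unfolding mgt_solution_def by blast
    obtain Z where Z:
      "\<And>\<xi>. mode_solution \<tau> m 0 (norm \<xi>) (fourier \<psi>0 \<xi>) (fourier \<psi>1 \<xi>) (fourier \<psi>2 \<xi>) (\<lambda>t. Z t \<xi>)"
      "\<And>t. t \<ge> 0 \<Longrightarrow> integrable lborel (Z t)" "\<And>t x. t \<ge> 0 \<Longrightarrow> \<psi>z t x = inv_fourier (Z t) x"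
      using sol(2) unfolding mgt_solution_def by blast
    define B where "B \<xi> = K * sqrt \<delta> * (H1_norm (s + 1) \<psi>0 + H1_norm (s + 1) \<psi>1 + H1_norm s \<psi>2)
          * (1 + (norm \<xi>)\<^sup>2) powr (- (s - 2) / 2)" for \<xi> :: "real^'n"
    have "\<exists>w1 w2. controlled_mode (norm \<xi>) (\<lambda>t. Y t \<xi> - Z t \<xi>) w1 w2 (B \<xi>)" for \<xi>
    proof -
      define R where "R = (1 + (norm \<xi>)\<^sup>2) * sqrt ((1 + (norm \<xi>)\<^sup>2) * ((norm (fourier \<psi>0 \<xi>))\<^sup>2 + (norm (fourier \<psi>1 \<xi>))\<^sup>2)
          + (norm (fourier \<psi>2 \<xi>))\<^sup>2)"
      have "K * sqrt \<delta> * R \<le> K * sqrt \<delta> * ((H1_norm (s + 1) \<psi>0 + H1_norm (s + 1) \<psi>1 + H1_norm s \<psi>2) *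
                (1 + (norm \<xi>)\<^sup>2) powr (- (s - 2) / 2))"
        unfolding R_def using K(1) \<delta> by (intro mult_left_mono mode_data_bound data) auto
      then have R: "K * sqrt \<delta> * R \<le> B \<xi>" unfolding B_def by (simp only: mult.assoc)
      obtain w1 w2 where "controlled_mode (norm \<xi>) (\<lambda>t. Y t \<xi> - Z t \<xi>) w1 w2 (K * sqrt \<delta> * R)"
        using K(2)[OF norm_ge_zero \<delta> Y(1)[of \<xi>] Z(1)[of \<xi>], folded R_def] by blast
      then show ?thesis using controlled_mode_mono R by blast
    qed
    \<comment> \<open>The derivatives are chosen separately at each frequency; their measurability
      in \<open>\<xi>\<close> is obtained later from difference quotients.\<close>
    then obtain w1 w2 where w: "\<And>\<xi>. controlled_mode (norm \<xi>) (\<lambda>t. Y t \<xi> - Z t \<xi>) (w1 \<xi>) (w2 \<xi>) (B \<xi>)"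
      by metis
    have "controlled_field (\<lambda>t x. \<psi>\<delta> t x - \<psi>z t x) (\<lambda>t \<xi>. Y t \<xi> - Z t \<xi>) (\<lambda>t \<xi>. w1 \<xi> t) (\<lambda>t \<xi>. w2 \<xi> t) B"
      unfolding controlled_field_def using Y Z w by (simp add: inv_fourier_diff)
    then show "\<exists>W W1 W2. controlled_field (\<lambda>t x. \<psi>\<delta> t x - \<psi>z t x) W W1 W2
        (\<lambda>\<xi>. K * sqrt \<delta> * (H1_norm (s + 1) \<psi>0 + H1_norm (s + 1) \<psi>1 + H1_norm s \<psi>2)
          * (1 + (norm \<xi>)\<^sup>2) powr (- (s - 2) / 2))"
      unfolding B_def by blast
  qed
qed

text \<open>The coefficient in the norm is at most \<open>1 / \<tau>\<close> for every
  \<open>\<delta> \<ge> 0\<close>, so each of the two summands is bounded by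
  \<open>1 + 1 / \<tau>\<close> times the integral of \<open>G\<close>.\<close>

lemma E_inf_norm_le:
  fixes W W1 W2 :: "real \<Rightarrow> real^'n \<Rightarrow> complex"
  assumes \<tau>: "\<tau> > 0" and \<delta>: "\<delta> \<ge> 0" and t: "t \<ge> 0"
    and cf: "controlled_field u W W1 W2 G"
    and G: "integrable lborel G"
  shows "E_inf_norm \<tau> \<delta> u t \<le> ereal (2 * (1 + 1 / \<tau>) * (LINT \<xi>|lborel. G \<xi>))"
proof -
  note W = controlled_fieldD(1,2)[OF cf] and d = controlled_fieldD(4,5)[OF cf]
    and le = controlled_fieldD(6-9)[OF cf]
  define k where "k = (\<delta> + 2 * \<tau>) / (2 * \<tau> * (\<delta> + \<tau>))"
  define \<kappa> where "\<kappa> = complex_of_real k"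
  have k: "0 \<le> k" using \<tau> \<delta> by (simp add: k_def)
  have k_le: "k \<le> 1 / \<tau>"
  proof -
    \<comment> \<open>The right-hand side equals \<open>2 * (\<delta> + \<tau>)\<close>.\<close>
    have "\<delta> + 2 * \<tau> \<le> 1 / \<tau> * (2 * \<tau> * (\<delta> + \<tau>))" using \<tau> \<delta> by simp
    then show ?thesis unfolding k_def using \<tau> \<delta> by (subst pos_divide_le_eq) auto
  qed
  have n\<kappa>: "norm \<kappa> = k" using k by (simp add: \<kappa>_def)
  define c where "c = 1 + 1 / \<tau>"
  have G0: "0 \<le> G \<xi>" for \<xi> using le(1)[OF order_refl, of \<xi>] norm_ge_zero order_trans by blast
  have cG: "a + k * b \<le> c * G \<xi>" if "a \<le> G \<xi>" "b \<le> G \<xi>" for a b \<xi>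
  proof -
    have "k * b \<le> k * G \<xi>" using that k by (intro mult_left_mono)
    also have "\<dots> \<le> 1 / \<tau> * G \<xi>" using k_le G0 by (intro mult_right_mono)
    finally show ?thesis using that by (simp add: c_def distrib_right)
  qed
  have int1: "integrable lborel (W1 t)" if "t \<ge> 0" for t
    by (rule integrable_time_derivative[OF W(1) d(1) le(1) G that])
  have int2: "integrable lborel (W2 t)" if "t \<ge> 0" for t
    by (rule integrable_time_derivative[OF int1 d(2) le(2) G that])
  have td1: "time_derivative u (\<lambda>t. inv_fourier (W1 t))"
    by (rule time_derivative_cong[OF time_derivative_inv_fourier[OF W(1) d(1) le(1) G] W(2)])
  have td2: "time_derivative (\<lambda>t. inv_fourier (W1 t)) (\<lambda>t. inv_fourier (W2 t))"
    by (rule time_derivative_inv_fourier[OF int1 d(2) le(2) G])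
  define D where "D F = (\<lambda>\<xi>. complex_of_real (norm \<xi>) * F \<xi>)" for F :: "real^'n \<Rightarrow> complex"
  have meas: "D F \<in> borel_measurable borel" if "integrable lborel F" for F
    using borel_measurable_integrable[OF that] unfolding D_def by simp
  have intD: "integrable lborel (D F)" if "integrable lborel F" "\<And>\<xi>. norm \<xi> * norm (F \<xi>) \<le> G \<xi>" for F
    by (rule Bochner_Integration.integrable_bound[OF G])
       (use that meas[OF that(1)] G0 in \<open>auto intro!: AE_I2 simp: D_def norm_mult\<close>)
  have ad: "abs_D (u t) (inv_fourier (D (W t)))" "abs_D (inv_fourier (W1 t)) (inv_fourier (D (W1 t)))"
    unfolding abs_D_def using W t int1 intD[OF W(1)[OF t] le(3)[OF t]] intD[OF int1[OF t] le(4)[OF t]]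
    unfolding D_def by blast+
  have linf: "Linf_norm (\<lambda>x. inv_fourier A x + \<kappa> * inv_fourier B x) \<le> ereal (LINT \<xi>|lborel. c * G \<xi>)"
    if "integrable lborel A" "integrable lborel B" "\<And>\<xi>. norm (A \<xi>) \<le> G \<xi>" "\<And>\<xi>. norm (B \<xi>) \<le> G \<xi>" for A B
  proof -
    have "Linf_norm (\<lambda>x. inv_fourier A x + \<kappa> * inv_fourier B x) = Linf_norm (inv_fourier (\<lambda>\<xi>. A \<xi> + \<kappa> * B \<xi>))"
      using that by (intro arg_cong[where f = Linf_norm] ext) (simp add: inv_fourier_add inv_fourier_mult_left)
    also have "\<dots> \<le> ereal (LINT \<xi>|lborel. c * G \<xi>)"
    proof (rule Linf_norm_inv_fourier_le)
      show "(\<lambda>\<xi>. A \<xi> + \<kappa> * B \<xi>) \<in> borel_measurable borel"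
        using that(1,2)[THEN borel_measurable_integrable] by simp
      show "integrable lborel (\<lambda>\<xi>. c * G \<xi>)" using G by simp
      show "norm (A \<xi> + \<kappa> * B \<xi>) \<le> c * G \<xi>" for \<xi>
        using norm_triangle_ineq[of "A \<xi>" "\<kappa> * B \<xi>"] cG[OF that(3,4)] by (simp add: norm_mult n\<kappa> order_trans)
    qed
    finally show ?thesis .
  qed
  have "E_inf_norm \<tau> \<delta> u t \<le> Linf_norm (\<lambda>x. inv_fourier (D (W1 t)) x + \<kappa> * inv_fourier (D (W t)) x)
      + Linf_norm (\<lambda>x. inv_fourier (W2 t) x + \<kappa> * inv_fourier (W1 t) x)"
    \<comment> \<open>An infimum is bounded by exhibiting one admissible choice: the fields
      synthesised from \<open>W1\<close>, \<open>W2\<close> and their products with the modulus of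
      the frequency.\<close>
    unfolding E_inf_norm_def Let_def k_def[symmetric] \<kappa>_def[symmetric]
    by (intro Inf_lower CollectI exI[of _ "\<lambda>t. inv_fourier (W1 t)"] exI[of _ "\<lambda>t. inv_fourier (W2 t)"]
          exI[of _ "inv_fourier (D (W t))"] exI[of _ "inv_fourier (D (W1 t))"] conjI refl td1 td2 ad)
  also have "\<dots> \<le> ereal (LINT \<xi>|lborel. c * G \<xi>) + ereal (LINT \<xi>|lborel. c * G \<xi>)"
    using t le W(1) int1 int2 intD by (intro add_mono linf) (auto simp: D_def norm_mult)
  also have "\<dots> = ereal (2 * (1 + 1 / \<tau>) * (LINT \<xi>|lborel. G \<xi>))" by (simp add: c_def)
  finally show ?thesis .
qed

theorem theorem2p3:
  fixes \<tau> m :: real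
  assumes "\<tau> > 0" and "m > 0" and "m * \<tau> < 1"
  shows "\<exists>\<delta>0>0.
    (\<forall>s0 > real CARD('n) + 2. \<exists>C>0. \<forall>\<delta>. 0 < \<delta> \<and> \<delta> \<le> \<delta>0 \<longrightarrow>
      (\<forall>(\<psi>0 :: real^'n \<Rightarrow> complex) \<psi>1 \<psi>2 \<psi>\<delta> \<psi>z.
        \<psi>0 \<in> H1_space (s0 + 1) \<and> \<psi>1 \<in> H1_space (s0 + 1) \<and> \<psi>2 \<in> H1_space s0 \<and>
        mgt_solution \<tau> m \<delta> \<psi>0 \<psi>1 \<psi>2 \<psi>\<delta> \<and> mgt_solution \<tau> m 0 \<psi>0 \<psi>1 \<psi>2 \<psi>z \<longrightarrow>
        (SUP t\<in>{0..}. E_inf_norm \<tau> \<delta> (\<lambda>t x. \<psi>\<delta> t x - \<psi>z t x) t)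
          \<le> ereal (C * sqrt \<delta> * (H1_norm (s0 + 1) \<psi>0 + H1_norm (s0 + 1) \<psi>1 + H1_norm s0 \<psi>2)))) \<and>
    (\<forall>s1 > real CARD('n) + 1. \<forall>T>0. \<exists>C>0. \<forall>\<delta>. 0 < \<delta> \<and> \<delta> \<le> \<delta>0 \<longrightarrow>
      (\<forall>(\<psi>0 :: real^'n \<Rightarrow> complex) \<psi>1 \<psi>2 \<psi>\<delta> \<psi>z.
        \<psi>0 \<in> H1_space (s1 + 1) \<inter> riesz1_space 1 \<and> \<psi>1 \<in> H1_space (s1 + 1) \<inter> riesz1_space 1 \<and>
        \<psi>2 \<in> H1_space s1 \<inter> riesz1_space 1 \<and>
        mgt_solution \<tau> m \<delta> \<psi>0 \<psi>1 \<psi>2 \<psi>\<delta> \<and> mgt_solution \<tau> m 0 \<psi>0 \<psi>1 \<psi>2 \<psi>z \<longrightarrow>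
        (SUP t\<in>{0..T}. Linf_norm (\<lambda>x. \<psi>\<delta> t x - \<psi>z t x))
          \<le> ereal (C * sqrt \<delta> *
              ((H1_norm (s1 + 1) \<psi>0 + riesz1_norm 1 \<psi>0) + (H1_norm (s1 + 1) \<psi>1 + riesz1_norm 1 \<psi>1)
               + (H1_norm s1 \<psi>2 + riesz1_norm 1 \<psi>2)))))"
proof -
  obtain K where K: "K > 0"
    "\<And>s \<delta> (\<psi>0 :: real^'n \<Rightarrow> complex) \<psi>1 \<psi>2 \<psi>\<delta> \<psi>z. 0 \<le> \<delta> \<Longrightarrow> \<delta> \<le> 1 \<Longrightarrow>
      \<psi>0 \<in> H1_space (s + 1) \<Longrightarrow> \<psi>1 \<in> H1_space (s + 1) \<Longrightarrow> \<psi>2 \<in> H1_space s \<Longrightarrow>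
      mgt_solution \<tau> m \<delta> \<psi>0 \<psi>1 \<psi>2 \<psi>\<delta> \<Longrightarrow> mgt_solution \<tau> m 0 \<psi>0 \<psi>1 \<psi>2 \<psi>z \<Longrightarrow>
      \<exists>W W1 W2. controlled_field (\<lambda>t x. \<psi>\<delta> t x - \<psi>z t x) W W1 W2
        (\<lambda>\<xi>. K * sqrt \<delta> * (H1_norm (s + 1) \<psi>0 + H1_norm (s + 1) \<psi>1 + H1_norm s \<psi>2)
          * (1 + (norm \<xi>)\<^sup>2) powr (- (s - 2) / 2))"
    by (rule mgt_difference_bound[OF assms]) blast
  define J where "J p \<xi> = (1 + (norm \<xi>)\<^sup>2) powr (- p / 2)" for p and \<xi> :: "real^'n"
  define I where "I p = (LINT \<xi>|lborel. J p \<xi>)" for p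
  have J: "integrable lborel (J p)" if "p > real CARD('n)" for p
    unfolding J_def by (rule integrable_japanese_bracket[OF that])
  have I0: "0 \<le> I p" for p unfolding I_def J_def by (intro integral_nonneg_AE AE_I2 powr_ge_zero)
  \<comment> \<open>The weight has order \<open>s0 - 2 > n\<close>, where \<open>n\<close> is the
    dimension, and is integrable. Adding 1 to the constant makes it positive, knowing only that
    \<open>I\<close> is nonnegative.\<close>
  have part1: "(SUP t\<in>{0..}. E_inf_norm \<tau> \<delta> (\<lambda>t x. \<psi>\<delta> t x - \<psi>z t x) t)
          \<le> ereal ((2 * (1 + 1 / \<tau>) * K * I (s0 - 2) + 1) * sqrt \<delta> * (H1_norm (s0 + 1) \<psi>0 + H1_norm (s0 + 1) \<psi>1 + H1_norm s0 \<psi>2))"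
    if s0: "s0 > real CARD('n) + 2" and \<delta>: "0 < \<delta>" "\<delta> \<le> 1" and data: "\<psi>0 \<in> H1_space (s0 + 1)" "\<psi>1 \<in> H1_space (s0 + 1)" "\<psi>2 \<in> H1_space s0"
      and sol: "mgt_solution \<tau> m \<delta> \<psi>0 \<psi>1 \<psi>2 \<psi>\<delta>" "mgt_solution \<tau> m 0 \<psi>0 \<psi>1 \<psi>2 \<psi>z"
    for s0 \<delta> and \<psi>0 \<psi>1 \<psi>2 :: "real^'n \<Rightarrow> complex" and \<psi>\<delta> \<psi>z
  proof (rule SUP_least)
    fix t :: real assume "t \<in> {0..}"
    then have t: "t \<ge> 0" by simp
    define N where "N = H1_norm (s0 + 1) \<psi>0 + H1_norm (s0 + 1) \<psi>1 + H1_norm s0 \<psi>2"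
    have N0: "0 \<le> N" by (simp add: N_def H1_norm_nonneg)
    obtain W W1 W2 where W: "controlled_field (\<lambda>t x. \<psi>\<delta> t x - \<psi>z t x) W W1 W2
        (\<lambda>\<xi>. K * sqrt \<delta> * N * J (s0 - 2) \<xi>)"
      using K(2)[OF less_imp_le[OF \<delta>(1)] \<delta>(2) data sol] unfolding N_def J_def by blast
    have "E_inf_norm \<tau> \<delta> (\<lambda>t x. \<psi>\<delta> t x - \<psi>z t x) t
        \<le> ereal (2 * (1 + 1 / \<tau>) * (LINT \<xi>|lborel. K * sqrt \<delta> * N * J (s0 - 2) \<xi>))"
      by (rule E_inf_norm_le[OF assms(1) less_imp_le[OF \<delta>(1)] t W]) (use J s0 in auto)
    also have "(LINT \<xi>|lborel. K * sqrt \<delta> * N * J (s0 - 2) \<xi>) = K * sqrt \<delta> * N * I (s0 - 2)"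
      by (simp add: I_def)
    also have "ereal (2 * (1 + 1 / \<tau>) * (K * sqrt \<delta> * N * I (s0 - 2))) \<le> ereal ((2 * (1 + 1 / \<tau>) * K * I (s0 - 2) + 1) * sqrt \<delta> * N)"
      using N0 \<delta> by (simp add: algebra_simps)
    finally show "E_inf_norm \<tau> \<delta> (\<lambda>t x. \<psi>\<delta> t x - \<psi>z t x) t
        \<le> ereal ((2 * (1 + 1 / \<tau>) * K * I (s0 - 2) + 1) * sqrt \<delta> * (H1_norm (s0 + 1) \<psi>0 + H1_norm (s0 + 1) \<psi>1 + H1_norm s0 \<psi>2))"
      unfolding N_def .
  qed
  have part2: "(SUP t\<in>{0..T}. Linf_norm (\<lambda>x. \<psi>\<delta> t x - \<psi>z t x))
          \<le> ereal (((T + 1) * K * I (s1 - 1) + 1) * sqrt \<delta> *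
              ((H1_norm (s1 + 1) \<psi>0 + riesz1_norm 1 \<psi>0) + (H1_norm (s1 + 1) \<psi>1 + riesz1_norm 1 \<psi>1)
               + (H1_norm s1 \<psi>2 + riesz1_norm 1 \<psi>2)))"
    if s1: "s1 > real CARD('n) + 1" and T: "T > 0" and \<delta>: "0 < \<delta>" "\<delta> \<le> 1"
      and data: "\<psi>0 \<in> H1_space (s1 + 1)" "\<psi>1 \<in> H1_space (s1 + 1)" "\<psi>2 \<in> H1_space s1"
      and sol: "mgt_solution \<tau> m \<delta> \<psi>0 \<psi>1 \<psi>2 \<psi>\<delta>" "mgt_solution \<tau> m 0 \<psi>0 \<psi>1 \<psi>2 \<psi>z"
    for s1 T \<delta> and \<psi>0 \<psi>1 \<psi>2 :: "real^'n \<Rightarrow> complex" and \<psi>\<delta> \<psi>z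
  proof (rule SUP_least)
    fix t assume t: "t \<in> {0..T}"
    define N where "N = H1_norm (s1 + 1) \<psi>0 + H1_norm (s1 + 1) \<psi>1 + H1_norm s1 \<psi>2"
    have N0: "0 \<le> N" by (simp add: N_def H1_norm_nonneg)
    obtain W W1 W2 where W: "controlled_field (\<lambda>t x. \<psi>\<delta> t x - \<psi>z t x) W W1 W2
        (\<lambda>\<xi>. K * sqrt \<delta> * N * J (s1 - 2) \<xi>)"
      using K(2)[OF less_imp_le[OF \<delta>(1)] \<delta>(2) data sol] unfolding N_def J_def by blast
    have t0: "t \<ge> 0" using t by simp
    note W = controlled_fieldD[OF W]
    \<comment> \<open>Integrating \<open>W1\<close> from zero data gives
      \<open>norm (W t \<xi>) \<le> B * T\<close>, while the elastic part gives
      \<open>norm \<xi> * norm (W t \<xi>) \<le> B\<close>. Together they gain one order of decay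
      over \<open>B\<close>, so the weight becomes \<open>J (s1 - 1)\<close>, which is integrable
      for \<open>s1 - 1 > n\<close> in dimension \<open>n\<close>.\<close>
    have W_le: "norm (W t \<xi>) \<le> (T + 1) * (K * sqrt \<delta> * N) * J (s1 - 1) \<xi>" for \<xi>
    proof -
      define B where "B = K * sqrt \<delta> * N * J (s1 - 2) \<xi>"
      have B0: "B \<ge> 0" using K(1) \<delta> N0 by (simp add: B_def J_def)
      have "norm (W t \<xi> - W 0 \<xi>) \<le> B * \<bar>t - 0\<bar>"
        by (rule vector_derivative_bound[of "\<lambda>t. W t \<xi>"]) (use W(4,6) t in \<open>auto simp: B_def\<close>)
      also have "\<dots> \<le> B * T" using t B0 by (intro mult_left_mono) auto
      finally have 1: "norm (W t \<xi>) \<le> B * T" by (simp add: W(3)[OF t0])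
      have 2: "norm \<xi> * norm (W t \<xi>) \<le> B" unfolding B_def by (rule W(8)[OF t0])
      have "sqrt (1 + (norm \<xi>)\<^sup>2) \<le> 1 + norm \<xi>"
        by (rule real_le_lsqrt) (auto simp: power2_sum)
      then have "sqrt (1 + (norm \<xi>)\<^sup>2) * norm (W t \<xi>) \<le> (1 + norm \<xi>) * norm (W t \<xi>)"
        by (rule mult_right_mono) simp
      also have "\<dots> \<le> (T + 1) * B" using 1 2 by (simp add: algebra_simps)
      finally have 3: "sqrt (1 + (norm \<xi>)\<^sup>2) * norm (W t \<xi>) \<le> (T + 1) * B" .
      have "1 + (norm \<xi>)\<^sup>2 > 0" by (simp add: add_pos_nonneg)
      then have "J (s1 - 2) \<xi> = sqrt (1 + (norm \<xi>)\<^sup>2) * J (s1 - 1) \<xi>"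
        using powr_add[of "1 + (norm \<xi>)\<^sup>2" "1 / 2" "- (s1 - 1) / 2"]
        by (simp add: J_def powr_half_sqrt flip: add_divide_distrib)
      then have "sqrt (1 + (norm \<xi>)\<^sup>2) * norm (W t \<xi>) \<le> sqrt (1 + (norm \<xi>)\<^sup>2) * ((T + 1) * (K * sqrt \<delta> * N) * J (s1 - 1) \<xi>)"
        using 3 by (simp add: B_def algebra_simps)
      then show ?thesis using \<open>1 + (norm \<xi>)\<^sup>2 > 0\<close> by (simp only: mult_le_cancel_left_pos real_sqrt_gt_zero)
    qed
    have "Linf_norm (\<lambda>x. \<psi>\<delta> t x - \<psi>z t x) = Linf_norm (inv_fourier (W t))"
      by (intro arg_cong[where f = Linf_norm] ext W(2)[OF t0])
    also have "\<dots> \<le> ereal (LINT \<xi>|lborel. (T + 1) * (K * sqrt \<delta> * N) * J (s1 - 1) \<xi>)"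
      by (rule Linf_norm_inv_fourier_le[OF _ _ W_le])
         (use borel_measurable_integrable[OF W(1)[OF t0]] J s1 in auto)
    also have "\<dots> = ereal ((T + 1) * (K * sqrt \<delta> * N) * I (s1 - 1))"
      by (simp add: I_def)
    also have "\<dots> \<le> ereal (((T + 1) * K * I (s1 - 1) + 1) * sqrt \<delta> * N)"
      using N0 \<delta> by (simp add: algebra_simps)
    also have "\<dots> \<le> ereal (((T + 1) * K * I (s1 - 1) + 1) * sqrt \<delta> *
         ((H1_norm (s1 + 1) \<psi>0 + riesz1_norm 1 \<psi>0) + (H1_norm (s1 + 1) \<psi>1 + riesz1_norm 1 \<psi>1)
               + (H1_norm s1 \<psi>2 + riesz1_norm 1 \<psi>2)))"
      unfolding N_def ereal_less_eq using T K(1) I0 \<delta>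
      by (intro mult_left_mono add_mono) (auto simp: riesz1_norm_nonneg)
    finally show "Linf_norm (\<lambda>x. \<psi>\<delta> t x - \<psi>z t x) \<le> ereal (((T + 1) * K * I (s1 - 1) + 1) * sqrt \<delta> *
         ((H1_norm (s1 + 1) \<psi>0 + riesz1_norm 1 \<psi>0) + (H1_norm (s1 + 1) \<psi>1 + riesz1_norm 1 \<psi>1)
               + (H1_norm s1 \<psi>2 + riesz1_norm 1 \<psi>2)))" .
  qed
  show ?thesis
  \<comment> \<open>The mode estimates use smallness of \<open>\<delta>\<close> only as
    \<open>\<delta> \<le> 1\<close>, so 1 is the common threshold.\<close>
  proof (rule exI[of _ "1::real"], intro conjI allI impI)
    fix s0 :: real assume s0: "s0 > real CARD('n) + 2"
    have "2 * (1 + 1 / \<tau>) * K * I (s0 - 2) + 1 > 0"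
      using assms(1) K(1) I0 by (intro add_nonneg_pos mult_nonneg_nonneg) auto
    then show "\<exists>C>0. \<forall>\<delta>. 0 < \<delta> \<and> \<delta> \<le> 1 \<longrightarrow>
      (\<forall>(\<psi>0 :: real^'n \<Rightarrow> complex) \<psi>1 \<psi>2 \<psi>\<delta> \<psi>z.
        \<psi>0 \<in> H1_space (s0 + 1) \<and> \<psi>1 \<in> H1_space (s0 + 1) \<and> \<psi>2 \<in> H1_space s0 \<and>
        mgt_solution \<tau> m \<delta> \<psi>0 \<psi>1 \<psi>2 \<psi>\<delta> \<and> mgt_solution \<tau> m 0 \<psi>0 \<psi>1 \<psi>2 \<psi>z \<longrightarrow>
        (SUP t\<in>{0..}. E_inf_norm \<tau> \<delta> (\<lambda>t x. \<psi>\<delta> t x - \<psi>z t x) t)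
          \<le> ereal (C * sqrt \<delta> * (H1_norm (s0 + 1) \<psi>0 + H1_norm (s0 + 1) \<psi>1 + H1_norm s0 \<psi>2)))"
      using part1[OF s0] by blast
  next
    fix s1 T :: real assume s1: "s1 > real CARD('n) + 1" and T: "T > 0"
    have "(T + 1) * K * I (s1 - 1) + 1 > 0"
      using T K(1) I0 by (intro add_nonneg_pos mult_nonneg_nonneg) auto
    then show "\<exists>C>0. \<forall>\<delta>. 0 < \<delta> \<and> \<delta> \<le> 1 \<longrightarrow>
      (\<forall>(\<psi>0 :: real^'n \<Rightarrow> complex) \<psi>1 \<psi>2 \<psi>\<delta> \<psi>z.
        \<psi>0 \<in> H1_space (s1 + 1) \<inter> riesz1_space 1 \<and> \<psi>1 \<in> H1_space (s1 + 1) \<inter> riesz1_space 1 \<and>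
        \<psi>2 \<in> H1_space s1 \<inter> riesz1_space 1 \<and>
        mgt_solution \<tau> m \<delta> \<psi>0 \<psi>1 \<psi>2 \<psi>\<delta> \<and> mgt_solution \<tau> m 0 \<psi>0 \<psi>1 \<psi>2 \<psi>z \<longrightarrow>
        (SUP t\<in>{0..T}. Linf_norm (\<lambda>x. \<psi>\<delta> t x - \<psi>z t x))
          \<le> ereal (C * sqrt \<delta> *
              ((H1_norm (s1 + 1) \<psi>0 + riesz1_norm 1 \<psi>0) + (H1_norm (s1 + 1) \<psi>1 + riesz1_norm 1 \<psi>1)
               + (H1_norm s1 \<psi>2 + riesz1_norm 1 \<psi>2))))"
      using part2[OF s1 T] by blast
  qed simp
qed

end
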